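(* Let $\Sigma$ be a quasi-convergent $2$-polygraph and let $\psi^{\mathrm{QNF}}$ be a quasi-normal form labelling of $\Sigma$. Let $\mathcal{S}^{sd}(\Sigma,\psi^{\mathrm{QNF}})$ be a strictly decreasing Squier's completion of $\Sigma$ with respect to $\psi^{\mathrm{QNF}}$. If the labelling $\psi^{\mathrm{QNF}}$ is compatible with contexts and $(\Sigma,\psi^{\mathrm{QNF}})$ is Peiffer decreasing with respect to the extension $\mathcal{S}^{sd}(\Sigma,\psi^{\mathrm{QNF}})$, then $\mathcal{S}^{sd}(\Sigma,\psi^{\mathrm{QNF}})$ is a coherent presentation of the category presented by $\Sigma$.
   Context: **Polygraphs.** A $2$-polygraph $\Sigma=(\Sigma_0,\Sigma_1,\Sigma_2)$ consists of a directed graph with set of vertices ($0$-cells) $\Sigma_0$ and set of edges ($1$-cells) $\Sigma_1$, and a set $\Sigma_2$ (of $2$-cells) with maps $s_1,t_1:\Sigma_2\to\Sigma_1^*$, where $\Sigma_1^*$ is the free category on the graph, such that $s_1(\alpha)$ and $t_1(\alpha)$ are parallel for every $\alpha\in\Sigma_2$. The category presented by $\Sigma$ is the quotient of $\Sigma_1^*$ by the congruence generated by $\Sigma_2$. $\Sigma_2^*$ denotes the free $2$-category generated by $\Sigma$ and $\Sigma_2^\top$ the free $(2,1)$-category generated by $\Sigma$ (all $2$-cells invertible for $\star_1$; the inverse of $f$ is $f^-$). $\star_0$ (also written by juxtaposition) composes along $0$-cells and $\star_1$ along $1$-cells; $s_1,t_1$ are the $1$-source and $1$-target of a $2$-cell.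 A $2$-sphere is a pair $(f,g)$ of $2$-cells with $s_1(f)=s_1(g)$ and $t_1(f)=t_1(g)$. **Rewriting.** A rewriting step is a $2$-cell $u\varphi v$ of $\Sigma_2^*$ with $u,v$ $1$-cells of $\Sigma_1^*$ and $\varphi\in\Sigma_2$. A (finite, possibly empty) rewriting sequence $f_1\cdot\ldots\cdot f_k$ is a sequence of composable rewriting steps; it determines the $2$-cell $f_1\star_1\cdots\star_1 f_k$ of $\Sigma_2^*$. A branching is a pair $(f,g)$ of rewriting sequences with the same source; it is local if $f,g$ are rewriting steps. A confluence diagram of $(f,g)$ is a pair $(f\cdot f',g\cdot g')$ of rewriting sequences with the same target. $\Sigma$ is confluent if every branching has a confluence diagram. A local branching is aspherical if $f=g$; it is a Peiffer branching if it has the form $(fv,ug)$ with rewriting steps $f:u\Rightarrow u'$, $g:v\Rightarrow v'$ and $u,v$ composable; it is overlapping if neither aspherical nor Peiffer. A critical branching is an overlapping branching minimal for the order generated by $(f,g)\sqsubseteq(wfw',wgw')$, for composable $1$-cells $w,w'$. Branchings $(f,g)$ and $(g,f)$ are not distinguished. **Quasi-convergence and QNF labelling.** $\Sigma$ is quasi-terminating if every infinite sequence $(u_n)_{n\in\mathbb{N}}$ of $1$-cells with a rewriting step from $u_n$ to $u_{n+1}$ for all $n$ contains infinitely many occurrences of some $1$-cell. $\Sigma$ is quasi-convergent if it is confluent and quasi-terminating. A $1$-cell $u$ is a quasi-normal form if for every rewriting step from $u$ to a $1$-cell $v$ there is a rewriting sequence from $v$ to $u$; a quasi-normal form of $u$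 is a quasi-normal form $\widetilde u$ such that there is a rewriting sequence from $u$ to $\widetilde u$. For quasi-convergent $\Sigma$, fix for every $1$-cell $u$ of $\Sigma_1^*$ a quasi-normal form $\widetilde u$ of $u$, with $\widetilde u=\widetilde v$ whenever $u,v$ are congruent (equal in the presented category). For $1$-cells $u,v$ such that $u$ rewrites to $v$, $d(u,v)$ is the length of a shortest rewriting sequence from $u$ to $v$. The associated quasi-normal form labelling is $\psi^{\mathrm{QNF}}(f)=d(t_1(f),\widetilde{t_1(f)})\in\mathbb{N}$ for every rewriting step $f$, with $\mathbb{N}$ ordered by $<$. **Strict decreasingness.** A well-founded labelling of $\Sigma$ is a map $\psi$ from rewriting steps of $\Sigma$ to a set $W$ with a well-founded order $\prec$; $L^W(f)$ denotes the set of labels of the steps of a rewriting sequence $f$. A confluence diagram $(f\cdot f',g\cdot g')$ of a local branching $(f,g)$ is strictly decreasing if $k\prec\psi(f)$ for all $k\in L^W(f')$ and $k\prec\psi(g)$ for all $k\in L^W(g')$. $(\Sigma,\psi)$ is strictly decreasing if every local branching has a strictly decreasing confluence diagram with respect to $\psi$; a quasi-convergent $2$-polygraph is strictly decreasing with respect to any quasi-normal form labelling. The labelling $\psi$ is compatible with contexts if for every strictly decreasing confluence diagram $(f\cdot f',g\cdot g')$ of a local branching $(f,g)$ and all composable $1$-cells $u_1,u_2$ of $\Sigma_1^*$, the confluence diagram $(u_1fu_2\cdot u_1f'u_2,\;u_1gu_2\cdot u_1g'u_2)$ is strictly decreasing. **Globular extensions.** A globular extension of $\Sigma_2^\top$ is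 a set $\Gamma$ (of $3$-cells) with maps $s_2,t_2$ from $\Gamma$ to $2$-cells of $\Sigma_2^\top$ such that $s_2(A),t_2(A)$ are parallel for all $A\in\Gamma$. A pair $(\Sigma,\Gamma)$ is a $(3,1)$-polygraph; it generates a free $(3,1)$-category (a $3$-category with all $2$-cells and $3$-cells invertible). Write $f\equiv_\Gamma g$ if $f,g$ become equal in the quotient of $\Sigma_2^\top$ by the congruence on $2$-cells generated by $\Gamma$. $(\Sigma,\Gamma)$ is a coherent presentation of the category presented by $\Sigma$ if for every $2$-sphere $(f,g)$ of $\Sigma_2^\top$ there is a $3$-cell from $f$ to $g$ in the free $(3,1)$-category generated by $(\Sigma,\Gamma)$. **Peiffer decreasingness.** A strictly decreasing $(\Sigma,\psi)$ is Peiffer decreasing with respect to a globular extension $\Gamma$ if for every Peiffer branching $(fv,ug):uv\Rightarrow(u'v,uv')$ there is a strictly decreasing confluence diagram $(fv\cdot f',ug\cdot g')$ such that $u'g\star_1(fv')^-\equiv_\Gamma f'\star_1(g')^-$. **Loops.** A $2$-loop is a $2$-cell $f$ of $\Sigma_2^*$ with $s_1(f)=t_1(f)$. Two $2$-loops $f,g$ are equivalent if there are a decomposition $f=f_1\star_1\cdots\star_1f_p$ into rewriting steps and a circular permutation $\sigma$ with $g=f_{\sigma(1)}\star_1\cdots\star_1f_{\sigma(p)}$. A $2$-loop $f$ is minimal with respect to $1$-composition if in any decomposition $f=g\star_1h\star_1k$ in $\Sigma_2^*$ with $h$ a $2$-loop, $h$ is an identity or equals $f$; it is minimal by context if there is no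 decomposition $f=ugv$ with $u,v$ nonidentity $1$-cells and $g$ a $2$-loop; it is elementary if it is minimal in both senses. A loop extension $\mathcal{L}(\Sigma)$ is a globular extension of $\Sigma_2^\top$ made of $3$-cells $A_\alpha:\alpha\Rrightarrow 1_{s_1(\alpha)}$ for exactly one representative $\alpha$ of each equivalence class of elementary $2$-loops. **Squier's completion.** A family of generating strictly decreasing confluences $\mathcal{O}(\Sigma,\psi)$ is a globular extension of $\Sigma_2^\top$ containing, for every critical branching $(f,g)$, exactly one $3$-cell $D^\psi_{f,g}:f\star_1f'\Rrightarrow g\star_1g'$ where $(f\cdot f',g\cdot g')$ is a strictly decreasing confluence diagram with respect to $\psi$. A strictly decreasing Squier's completion $\mathcal{S}^{sd}(\Sigma,\psi)$ is the $(3,1)$-polygraph extending $\Sigma$ by $\mathcal{O}(\Sigma,\psi)\cup\mathcal{L}(\Sigma)$ for some such choices. "With respect to the extension $\mathcal{S}^{sd}(\Sigma,\psi)$" means with respect to this globular extension. *)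

theory Defs
  imports "Graph_Theory.Digraph" "Graph_Theory.Arc_Walk"
begin

section \<open>2-polygraphs and the free category on the graph\<close>

text \<open>
  A 1-cell of the free category is given by its 0-source and the list of its edges, so that the
  identity of \<open>x\<close> is \<open>Path x []\<close>.  Edges are listed in diagrammatic order.
\<close>

datatype ('v, 'e) path = Path (src0: 'v) (edges: "'e list")

record ('v, 'e, 'r) polygraph2 =
  graph :: "('v, 'e) pre_digraph"
  rules :: "'r set"
  rsrc :: "'r \<Rightarrow> ('v, 'e) path"
  rtgt :: "'r \<Rightarrow> ('v, 'e) path"

definition cells1 :: "('v, 'e, 'r) polygraph2 \<Rightarrow> ('v, 'e) path set" where
  "cells1 \<Sigma> = {u. \<exists>y. pre_digraph.awalk (graph \<Sigma>) (src0 u) (edges u) y}"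

definition tgt0 :: "('v, 'e, 'r) polygraph2 \<Rightarrow> ('v, 'e) path \<Rightarrow> 'v" where
  "tgt0 \<Sigma> u = pre_digraph.awlast (graph \<Sigma>) (src0 u) (edges u)"

definition id1 :: "'v \<Rightarrow> ('v, 'e) path" where
  "id1 x = Path x []"

definition is_id1 :: "('v, 'e) path \<Rightarrow> bool" where
  "is_id1 u \<longleftrightarrow> edges u = []"

definition pcomp :: "('v, 'e) path \<Rightarrow> ('v, 'e) path \<Rightarrow> ('v, 'e) path" (infixr \<open>\<bullet>\<close> 75) where
  "u \<bullet> v = Path (src0 u) (edges u @ edges v)"

definition two_polygraph :: "('v, 'e, 'r) polygraph2 \<Rightarrow> bool" where
  "two_polygraph \<Sigma> \<longleftrightarrow>
     wf_digraph (graph \<Sigma>) \<and>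
     (\<forall>\<phi>\<in>rules \<Sigma>. rsrc \<Sigma> \<phi> \<in> cells1 \<Sigma> \<and> rtgt \<Sigma> \<phi> \<in> cells1 \<Sigma> \<and>
        src0 (rsrc \<Sigma> \<phi>) = src0 (rtgt \<Sigma> \<phi>) \<and> tgt0 \<Sigma> (rsrc \<Sigma> \<phi>) = tgt0 \<Sigma> (rtgt \<Sigma> \<phi>))"

text \<open>Two 1-cells are equal in the presented category iff they are related by \<open>cong1\<close>.\<close>

inductive cong1 :: "('v, 'e, 'r) polygraph2 \<Rightarrow> ('v, 'e) path \<Rightarrow> ('v, 'e) path \<Rightarrow> bool"
  for \<Sigma> where
  rule: "\<phi> \<in> rules \<Sigma> \<Longrightarrow> cong1 \<Sigma> (rsrc \<Sigma> \<phi>) (rtgt \<Sigma> \<phi>)"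
| refl: "u \<in> cells1 \<Sigma> \<Longrightarrow> cong1 \<Sigma> u u"
| sym: "cong1 \<Sigma> u v \<Longrightarrow> cong1 \<Sigma> v u"
| trans: "cong1 \<Sigma> u v \<Longrightarrow> cong1 \<Sigma> v w \<Longrightarrow> cong1 \<Sigma> u w"
| comp: "cong1 \<Sigma> u u' \<Longrightarrow> cong1 \<Sigma> v v' \<Longrightarrow> tgt0 \<Sigma> u = src0 v \<Longrightarrow> cong1 \<Sigma> (u \<bullet> v) (u' \<bullet> v')"


section \<open>The free 2-category and the free (2,1)-category\<close>

text \<open>
  Cells of the free (2,1)-category are represented by well-typed formal composites of
  generators, identities and formal inverses; equality of cells is the smallest congruence
  containing the axioms of (2,1)-categories.  Cells of the free 2-category are represented by
  the composites without formal inverses, equality being the smallest congruence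
  \<^emph>\<open>on these composites\<close> containing the axioms of 2-categories.
\<close>

datatype ('v, 'e, 'r) term2 =
    Gen2 'r
  | Id2 "('v, 'e) path"
  | Comp0 "('v, 'e, 'r) term2" "('v, 'e, 'r) term2" (infixr \<open>\<star>\<^sub>0\<close> 72)
  | Comp1 "('v, 'e, 'r) term2" "('v, 'e, 'r) term2" (infixr \<open>\<star>\<^sub>1\<close> 71)
  | Inv2 "('v, 'e, 'r) term2"

fun src1 :: "('v, 'e, 'r) polygraph2 \<Rightarrow> ('v, 'e, 'r) term2 \<Rightarrow> ('v, 'e) path"
  and tgt1 :: "('v, 'e, 'r) polygraph2 \<Rightarrow> ('v, 'e, 'r) term2 \<Rightarrow> ('v, 'e) path" where
  "src1 \<Sigma> (Gen2 \<phi>) = rsrc \<Sigma> \<phi>"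
| "src1 \<Sigma> (Id2 u) = u"
| "src1 \<Sigma> (f \<star>\<^sub>0 g) = src1 \<Sigma> f \<bullet> src1 \<Sigma> g"
| "src1 \<Sigma> (f \<star>\<^sub>1 g) = src1 \<Sigma> f"
| "src1 \<Sigma> (Inv2 f) = tgt1 \<Sigma> f"
| "tgt1 \<Sigma> (Gen2 \<phi>) = rtgt \<Sigma> \<phi>"
| "tgt1 \<Sigma> (Id2 u) = u"
| "tgt1 \<Sigma> (f \<star>\<^sub>0 g) = tgt1 \<Sigma> f \<bullet> tgt1 \<Sigma> g"
| "tgt1 \<Sigma> (f \<star>\<^sub>1 g) = tgt1 \<Sigma> g"
| "tgt1 \<Sigma> (Inv2 f) = src1 \<Sigma> f"

primrec typed2 :: "('v, 'e, 'r) polygraph2 \<Rightarrow> ('v, 'e, 'r) term2 \<Rightarrow> bool" where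
  "typed2 \<Sigma> (Gen2 \<phi>) \<longleftrightarrow> \<phi> \<in> rules \<Sigma>"
| "typed2 \<Sigma> (Id2 u) \<longleftrightarrow> u \<in> cells1 \<Sigma>"
| "typed2 \<Sigma> (f \<star>\<^sub>0 g) \<longleftrightarrow> typed2 \<Sigma> f \<and> typed2 \<Sigma> g \<and> tgt0 \<Sigma> (src1 \<Sigma> f) = src0 (src1 \<Sigma> g)"
| "typed2 \<Sigma> (f \<star>\<^sub>1 g) \<longleftrightarrow> typed2 \<Sigma> f \<and> typed2 \<Sigma> g \<and> tgt1 \<Sigma> f = src1 \<Sigma> g"
| "typed2 \<Sigma> (Inv2 f) \<longleftrightarrow> typed2 \<Sigma> f"

primrec inverse_free :: "('v, 'e, 'r) term2 \<Rightarrow> bool" where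
  "inverse_free (Gen2 \<phi>) \<longleftrightarrow> True"
| "inverse_free (Id2 u) \<longleftrightarrow> True"
| "inverse_free (f \<star>\<^sub>0 g) \<longleftrightarrow> inverse_free f \<and> inverse_free g"
| "inverse_free (f \<star>\<^sub>1 g) \<longleftrightarrow> inverse_free f \<and> inverse_free g"
| "inverse_free (Inv2 f) \<longleftrightarrow> False"

definition cells21 :: "('v, 'e, 'r) polygraph2 \<Rightarrow> ('v, 'e, 'r) term2 set" where
  "cells21 \<Sigma> = {f. typed2 \<Sigma> f}"

definition cells2 :: "('v, 'e, 'r) polygraph2 \<Rightarrow> ('v, 'e, 'r) term2 set" where
  "cells2 \<Sigma> = {f. typed2 \<Sigma> f \<and> inverse_free f}"

text \<open>
  The congruence on the set \<open>T\<close> of terms generated by the axioms and the relation \<open>R\<close>.  The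
  axioms for inverses have no instance when the terms of \<open>T\<close> are inverse-free.
\<close>

inductive cong2 :: "('v, 'e, 'r) polygraph2 \<Rightarrow> ('v, 'e, 'r) term2 set \<Rightarrow>
    ('v, 'e, 'r) term2 rel \<Rightarrow> ('v, 'e, 'r) term2 \<Rightarrow> ('v, 'e, 'r) term2 \<Rightarrow> bool"
  for \<Sigma> T R where
  gen: "(f, g) \<in> R \<Longrightarrow> cong2 \<Sigma> T R f g"
| refl: "f \<in> T \<Longrightarrow> cong2 \<Sigma> T R f f"
| sym: "cong2 \<Sigma> T R f g \<Longrightarrow> cong2 \<Sigma> T R g f"
| trans: "cong2 \<Sigma> T R f g \<Longrightarrow> cong2 \<Sigma> T R g h \<Longrightarrow> cong2 \<Sigma> T R f h"
| comp0: "cong2 \<Sigma> T R f f' \<Longrightarrow> cong2 \<Sigma> T R g g' \<Longrightarrow> f \<star>\<^sub>0 g \<in> T \<Longrightarrow> cong2 \<Sigma> T R (f \<star>\<^sub>0 g) (f' \<star>\<^sub>0 g')"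
| comp1: "cong2 \<Sigma> T R f f' \<Longrightarrow> cong2 \<Sigma> T R g g' \<Longrightarrow> f \<star>\<^sub>1 g \<in> T \<Longrightarrow> cong2 \<Sigma> T R (f \<star>\<^sub>1 g) (f' \<star>\<^sub>1 g')"
| inv: "cong2 \<Sigma> T R f f' \<Longrightarrow> Inv2 f \<in> T \<Longrightarrow> cong2 \<Sigma> T R (Inv2 f) (Inv2 f')"
| assoc0: "(f \<star>\<^sub>0 g) \<star>\<^sub>0 h \<in> T \<Longrightarrow> cong2 \<Sigma> T R ((f \<star>\<^sub>0 g) \<star>\<^sub>0 h) (f \<star>\<^sub>0 (g \<star>\<^sub>0 h))"
| assoc1: "(f \<star>\<^sub>1 g) \<star>\<^sub>1 h \<in> T \<Longrightarrow> cong2 \<Sigma> T R ((f \<star>\<^sub>1 g) \<star>\<^sub>1 h) (f \<star>\<^sub>1 (g \<star>\<^sub>1 h))"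
| unit0_left: "f \<in> T \<Longrightarrow> cong2 \<Sigma> T R (Id2 (id1 (src0 (src1 \<Sigma> f))) \<star>\<^sub>0 f) f"
| unit0_right: "f \<in> T \<Longrightarrow> cong2 \<Sigma> T R (f \<star>\<^sub>0 Id2 (id1 (tgt0 \<Sigma> (src1 \<Sigma> f)))) f"
| unit1_left: "f \<in> T \<Longrightarrow> cong2 \<Sigma> T R (Id2 (src1 \<Sigma> f) \<star>\<^sub>1 f) f"
| unit1_right: "f \<in> T \<Longrightarrow> cong2 \<Sigma> T R (f \<star>\<^sub>1 Id2 (tgt1 \<Sigma> f)) f"
| id_comp0: "Id2 u \<star>\<^sub>0 Id2 v \<in> T \<Longrightarrow> cong2 \<Sigma> T R (Id2 u \<star>\<^sub>0 Id2 v) (Id2 (u \<bullet> v))"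
| exchange: "(f \<star>\<^sub>1 f') \<star>\<^sub>0 (g \<star>\<^sub>1 g') \<in> T \<Longrightarrow>
    cong2 \<Sigma> T R ((f \<star>\<^sub>1 f') \<star>\<^sub>0 (g \<star>\<^sub>1 g')) ((f \<star>\<^sub>0 g) \<star>\<^sub>1 (f' \<star>\<^sub>0 g'))"
| inv_right: "Inv2 f \<in> T \<Longrightarrow> cong2 \<Sigma> T R (f \<star>\<^sub>1 Inv2 f) (Id2 (src1 \<Sigma> f))"
| inv_left: "Inv2 f \<in> T \<Longrightarrow> cong2 \<Sigma> T R (Inv2 f \<star>\<^sub>1 f) (Id2 (tgt1 \<Sigma> f))"

definition eq2 :: "('v, 'e, 'r) polygraph2 \<Rightarrow> ('v, 'e, 'r) term2 \<Rightarrow> ('v, 'e, 'r) term2 \<Rightarrow> bool" where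
  "eq2 \<Sigma> = cong2 \<Sigma> (cells2 \<Sigma>) {}"

definition eq21 :: "('v, 'e, 'r) polygraph2 \<Rightarrow> ('v, 'e, 'r) term2 \<Rightarrow> ('v, 'e, 'r) term2 \<Rightarrow> bool" where
  "eq21 \<Sigma> = cong2 \<Sigma> (cells21 \<Sigma>) {}"


section \<open>Globular extensions, free (3,1)-categories and coherence\<close>

record ('v, 'e, 'r, 'a) cells3_ext =
  gens3 :: "'a set"
  gsrc :: "'a \<Rightarrow> ('v, 'e, 'r) term2"
  gtgt :: "'a \<Rightarrow> ('v, 'e, 'r) term2"

definition globular_extension ::
    "('v, 'e, 'r) polygraph2 \<Rightarrow> ('v, 'e, 'r, 'a) cells3_ext \<Rightarrow> bool" where
  "globular_extension \<Sigma> \<Gamma> \<longleftrightarrow>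
     (\<forall>A\<in>gens3 \<Gamma>. gsrc \<Gamma> A \<in> cells21 \<Sigma> \<and> gtgt \<Gamma> A \<in> cells21 \<Sigma> \<and>
        src1 \<Sigma> (gsrc \<Gamma> A) = src1 \<Sigma> (gtgt \<Gamma> A) \<and> tgt1 \<Sigma> (gsrc \<Gamma> A) = tgt1 \<Sigma> (gtgt \<Gamma> A))"

definition eqmod :: "('v, 'e, 'r) polygraph2 \<Rightarrow> ('v, 'e, 'r, 'a) cells3_ext \<Rightarrow>
    ('v, 'e, 'r) term2 \<Rightarrow> ('v, 'e, 'r) term2 \<Rightarrow> bool" where
  "eqmod \<Sigma> \<Gamma> = cong2 \<Sigma> (cells21 \<Sigma>) {(gsrc \<Gamma> A, gtgt \<Gamma> A) | A. A \<in> gens3 \<Gamma>}"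

text \<open>
  3-cells of the free (3,1)-category are represented by well-typed formal composites, where the
  2-dimensional boundaries are compared in the free (2,1)-category.  The axioms of
  (3,1)-categories only identify parallel composites; as only the existence of a 3-cell with a
  given boundary is ever needed, equality of 3-cells is not introduced.
\<close>

datatype ('v, 'e, 'r, 'a) term3 =
    Gen3 'a
  | Id3 "('v, 'e, 'r) term2"
  | Comp0_3 "('v, 'e, 'r, 'a) term3" "('v, 'e, 'r, 'a) term3"
  | Comp1_3 "('v, 'e, 'r, 'a) term3" "('v, 'e, 'r, 'a) term3"
  | Comp2_3 "('v, 'e, 'r, 'a) term3" "('v, 'e, 'r, 'a) term3"
  | Inv3 "('v, 'e, 'r, 'a) term3"

fun src2 :: "('v, 'e, 'r, 'a) cells3_ext \<Rightarrow> ('v, 'e, 'r, 'a) term3 \<Rightarrow> ('v, 'e, 'r) term2"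
  and tgt2 :: "('v, 'e, 'r, 'a) cells3_ext \<Rightarrow> ('v, 'e, 'r, 'a) term3 \<Rightarrow> ('v, 'e, 'r) term2" where
  "src2 \<Gamma> (Gen3 A) = gsrc \<Gamma> A"
| "src2 \<Gamma> (Id3 f) = f"
| "src2 \<Gamma> (Comp0_3 F G) = src2 \<Gamma> F \<star>\<^sub>0 src2 \<Gamma> G"
| "src2 \<Gamma> (Comp1_3 F G) = src2 \<Gamma> F \<star>\<^sub>1 src2 \<Gamma> G"
| "src2 \<Gamma> (Comp2_3 F G) = src2 \<Gamma> F"
| "src2 \<Gamma> (Inv3 F) = tgt2 \<Gamma> F"
| "tgt2 \<Gamma> (Gen3 A) = gtgt \<Gamma> A"
| "tgt2 \<Gamma> (Id3 f) = f"
| "tgt2 \<Gamma> (Comp0_3 F G) = tgt2 \<Gamma> F \<star>\<^sub>0 tgt2 \<Gamma> G"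
| "tgt2 \<Gamma> (Comp1_3 F G) = tgt2 \<Gamma> F \<star>\<^sub>1 tgt2 \<Gamma> G"
| "tgt2 \<Gamma> (Comp2_3 F G) = tgt2 \<Gamma> G"
| "tgt2 \<Gamma> (Inv3 F) = src2 \<Gamma> F"

primrec typed3 :: "('v, 'e, 'r) polygraph2 \<Rightarrow> ('v, 'e, 'r, 'a) cells3_ext \<Rightarrow>
    ('v, 'e, 'r, 'a) term3 \<Rightarrow> bool" where
  "typed3 \<Sigma> \<Gamma> (Gen3 A) \<longleftrightarrow> A \<in> gens3 \<Gamma>"
| "typed3 \<Sigma> \<Gamma> (Id3 f) \<longleftrightarrow> f \<in> cells21 \<Sigma>"
| "typed3 \<Sigma> \<Gamma> (Comp0_3 F G) \<longleftrightarrow> typed3 \<Sigma> \<Gamma> F \<and> typed3 \<Sigma> \<Gamma> G \<and>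
     tgt0 \<Sigma> (src1 \<Sigma> (src2 \<Gamma> F)) = src0 (src1 \<Sigma> (src2 \<Gamma> G))"
| "typed3 \<Sigma> \<Gamma> (Comp1_3 F G) \<longleftrightarrow> typed3 \<Sigma> \<Gamma> F \<and> typed3 \<Sigma> \<Gamma> G \<and>
     tgt1 \<Sigma> (src2 \<Gamma> F) = src1 \<Sigma> (src2 \<Gamma> G)"
| "typed3 \<Sigma> \<Gamma> (Comp2_3 F G) \<longleftrightarrow> typed3 \<Sigma> \<Gamma> F \<and> typed3 \<Sigma> \<Gamma> G \<and>
     eq21 \<Sigma> (tgt2 \<Gamma> F) (src2 \<Gamma> G)"
| "typed3 \<Sigma> \<Gamma> (Inv3 F) \<longleftrightarrow> typed3 \<Sigma> \<Gamma> F"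

definition cell3 :: "('v, 'e, 'r) polygraph2 \<Rightarrow> ('v, 'e, 'r, 'a) cells3_ext \<Rightarrow>
    ('v, 'e, 'r, 'a) term3 \<Rightarrow> ('v, 'e, 'r) term2 \<Rightarrow> ('v, 'e, 'r) term2 \<Rightarrow> bool" where
  "cell3 \<Sigma> \<Gamma> F f g \<longleftrightarrow> typed3 \<Sigma> \<Gamma> F \<and> eq21 \<Sigma> (src2 \<Gamma> F) f \<and> eq21 \<Sigma> (tgt2 \<Gamma> F) g"

definition sphere2 :: "('v, 'e, 'r) polygraph2 \<Rightarrow>
    ('v, 'e, 'r) term2 \<Rightarrow> ('v, 'e, 'r) term2 \<Rightarrow> bool" where
  "sphere2 \<Sigma> f g \<longleftrightarrow> f \<in> cells21 \<Sigma> \<and> g \<in> cells21 \<Sigma> \<and> src1 \<Sigma> f = src1 \<Sigma> g \<and> tgt1 \<Sigma> f = tgt1 \<Sigma> g"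

definition coherent_presentation ::
    "('v, 'e, 'r) polygraph2 \<Rightarrow> ('v, 'e, 'r, 'a) cells3_ext \<Rightarrow> bool" where
  "coherent_presentation \<Sigma> \<Gamma> \<longleftrightarrow>
     globular_extension \<Sigma> \<Gamma> \<and> (\<forall>f g. sphere2 \<Sigma> f g \<longrightarrow> (\<exists>F. cell3 \<Sigma> \<Gamma> F f g))"


section \<open>Rewriting\<close>

text \<open>
  The rewriting step \<open>u\<phi>v\<close> is represented by the triple of \<open>u\<close>, \<open>\<phi>\<close> and \<open>v\<close>, which is
  determined by the corresponding cell of the free 2-category.
\<close>

datatype ('v, 'e, 'r) step = Step "('v, 'e) path" 'r "('v, 'e) path"

primrec is_step :: "('v, 'e, 'r) polygraph2 \<Rightarrow> ('v, 'e, 'r) step \<Rightarrow> bool" where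
  "is_step \<Sigma> (Step u \<phi> v) \<longleftrightarrow> u \<in> cells1 \<Sigma> \<and> \<phi> \<in> rules \<Sigma> \<and> v \<in> cells1 \<Sigma> \<and>
     tgt0 \<Sigma> u = src0 (rsrc \<Sigma> \<phi>) \<and> tgt0 \<Sigma> (rsrc \<Sigma> \<phi>) = src0 v"

primrec ssrc :: "('v, 'e, 'r) polygraph2 \<Rightarrow> ('v, 'e, 'r) step \<Rightarrow> ('v, 'e) path" where
  "ssrc \<Sigma> (Step u \<phi> v) = u \<bullet> rsrc \<Sigma> \<phi> \<bullet> v"

primrec stgt :: "('v, 'e, 'r) polygraph2 \<Rightarrow> ('v, 'e, 'r) step \<Rightarrow> ('v, 'e) path" where
  "stgt \<Sigma> (Step u \<phi> v) = u \<bullet> rtgt \<Sigma> \<phi> \<bullet> v"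

primrec step_cell :: "('v, 'e, 'r) step \<Rightarrow> ('v, 'e, 'r) term2" where
  "step_cell (Step u \<phi> v) = Id2 u \<star>\<^sub>0 Gen2 \<phi> \<star>\<^sub>0 Id2 v"

primrec lwhisk :: "('v, 'e) path \<Rightarrow> ('v, 'e, 'r) step \<Rightarrow> ('v, 'e, 'r) step" where
  "lwhisk w (Step u \<phi> v) = Step (w \<bullet> u) \<phi> v"

primrec rwhisk :: "('v, 'e, 'r) step \<Rightarrow> ('v, 'e) path \<Rightarrow> ('v, 'e, 'r) step" where
  "rwhisk (Step u \<phi> v) w = Step u \<phi> (v \<bullet> w)"

definition whisk :: "('v, 'e) path \<Rightarrow> ('v, 'e, 'r) step \<Rightarrow> ('v, 'e) path \<Rightarrow> ('v, 'e, 'r) step" where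
  "whisk w f w' = lwhisk w (rwhisk f w')"

text \<open>\<open>rewr_seq \<Sigma> u fs v\<close>: the list \<open>fs\<close> is a rewriting sequence from \<open>u\<close> to \<open>v\<close>.\<close>

fun rewr_seq :: "('v, 'e, 'r) polygraph2 \<Rightarrow> ('v, 'e) path \<Rightarrow> ('v, 'e, 'r) step list \<Rightarrow>
    ('v, 'e) path \<Rightarrow> bool" where
  "rewr_seq \<Sigma> u [] v \<longleftrightarrow> u \<in> cells1 \<Sigma> \<and> u = v"
| "rewr_seq \<Sigma> u (f # fs) v \<longleftrightarrow> is_step \<Sigma> f \<and> ssrc \<Sigma> f = u \<and> rewr_seq \<Sigma> (stgt \<Sigma> f) fs v"

fun seq_cell :: "('v, 'e, 'r) polygraph2 \<Rightarrow> ('v, 'e) path \<Rightarrow> ('v, 'e, 'r) step list \<Rightarrow>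
    ('v, 'e, 'r) term2" where
  "seq_cell \<Sigma> u [] = Id2 u"
| "seq_cell \<Sigma> u (f # fs) = step_cell f \<star>\<^sub>1 seq_cell \<Sigma> (stgt \<Sigma> f) fs"

definition branching :: "('v, 'e, 'r) polygraph2 \<Rightarrow> ('v, 'e) path \<Rightarrow>
    ('v, 'e, 'r) step list \<Rightarrow> ('v, 'e, 'r) step list \<Rightarrow> ('v, 'e) path \<Rightarrow> ('v, 'e) path \<Rightarrow> bool" where
  "branching \<Sigma> u fs gs v w \<longleftrightarrow> rewr_seq \<Sigma> u fs v \<and> rewr_seq \<Sigma> u gs w"

definition confluent :: "('v, 'e, 'r) polygraph2 \<Rightarrow> bool" where
  "confluent \<Sigma> \<longleftrightarrow> (\<forall>u fs gs v w. branching \<Sigma> u fs gs v w \<longrightarrow>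
     (\<exists>fs' gs' x. rewr_seq \<Sigma> u (fs @ fs') x \<and> rewr_seq \<Sigma> u (gs @ gs') x))"

definition local_branching :: "('v, 'e, 'r) polygraph2 \<Rightarrow>
    ('v, 'e, 'r) step \<Rightarrow> ('v, 'e, 'r) step \<Rightarrow> bool" where
  "local_branching \<Sigma> f g \<longleftrightarrow> is_step \<Sigma> f \<and> is_step \<Sigma> g \<and> ssrc \<Sigma> f = ssrc \<Sigma> g"

definition peiffer_pair :: "('v, 'e, 'r) polygraph2 \<Rightarrow>
    ('v, 'e, 'r) step \<Rightarrow> ('v, 'e, 'r) step \<Rightarrow> bool" where
  "peiffer_pair \<Sigma> f g \<longleftrightarrow> is_step \<Sigma> f \<and> is_step \<Sigma> g \<and> tgt0 \<Sigma> (ssrc \<Sigma> f) = src0 (ssrc \<Sigma> g)"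

text \<open>
  Branchings are unordered pairs, whence the symmetrised notion of a Peiffer branching; the
  notions derived from it are then automatically symmetric.
\<close>

definition peiffer_branching :: "('v, 'e, 'r) polygraph2 \<Rightarrow>
    ('v, 'e, 'r) step \<Rightarrow> ('v, 'e, 'r) step \<Rightarrow> bool" where
  "peiffer_branching \<Sigma> f g \<longleftrightarrow> (\<exists>h k. peiffer_pair \<Sigma> h k \<and>
     {f, g} = {rwhisk h (ssrc \<Sigma> k), lwhisk (ssrc \<Sigma> h) k})"

definition overlapping :: "('v, 'e, 'r) polygraph2 \<Rightarrow>
    ('v, 'e, 'r) step \<Rightarrow> ('v, 'e, 'r) step \<Rightarrow> bool" where
  "overlapping \<Sigma> f g \<longleftrightarrow> local_branching \<Sigma> f g \<and> f \<noteq> g \<and> \<not> peiffer_branching \<Sigma> f g"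

definition context_of :: "('v, 'e, 'r) polygraph2 \<Rightarrow> ('v, 'e) path \<Rightarrow> ('v, 'e) path \<Rightarrow>
    ('v, 'e) path \<Rightarrow> bool" where
  "context_of \<Sigma> u w w' \<longleftrightarrow> w \<in> cells1 \<Sigma> \<and> w' \<in> cells1 \<Sigma> \<and> tgt0 \<Sigma> w = src0 u \<and> tgt0 \<Sigma> u = src0 w'"

text \<open>This relation on local branchings is already reflexive, transitive and antisymmetric.\<close>

definition branching_le :: "('v, 'e, 'r) polygraph2 \<Rightarrow>
    ('v, 'e, 'r) step \<times> ('v, 'e, 'r) step \<Rightarrow> ('v, 'e, 'r) step \<times> ('v, 'e, 'r) step \<Rightarrow> bool" where
  "branching_le \<Sigma> = (\<lambda>(f, g) (f', g').
     \<exists>w w'. context_of \<Sigma> (ssrc \<Sigma> f) w w' \<and> f' = whisk w f w' \<and> g' = whisk w g w')"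

definition critical :: "('v, 'e, 'r) polygraph2 \<Rightarrow>
    ('v, 'e, 'r) step \<Rightarrow> ('v, 'e, 'r) step \<Rightarrow> bool" where
  "critical \<Sigma> f g \<longleftrightarrow> overlapping \<Sigma> f g \<and>
     (\<forall>f0 g0. overlapping \<Sigma> f0 g0 \<and> branching_le \<Sigma> (f0, g0) (f, g) \<longrightarrow> (f0, g0) = (f, g))"


section \<open>Quasi-convergence and quasi-normal form labellings\<close>

definition quasi_terminating :: "('v, 'e, 'r) polygraph2 \<Rightarrow> bool" where
  "quasi_terminating \<Sigma> \<longleftrightarrow>
     (\<forall>u :: nat \<Rightarrow> ('v, 'e) path.
        (\<forall>n. \<exists>f. is_step \<Sigma> f \<and> ssrc \<Sigma> f = u n \<and> stgt \<Sigma> f = u (Suc n)) \<longrightarrow>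
        (\<exists>x. infinite {n. u n = x}))"

definition quasi_convergent :: "('v, 'e, 'r) polygraph2 \<Rightarrow> bool" where
  "quasi_convergent \<Sigma> \<longleftrightarrow> confluent \<Sigma> \<and> quasi_terminating \<Sigma>"

definition quasi_normal_form :: "('v, 'e, 'r) polygraph2 \<Rightarrow> ('v, 'e) path \<Rightarrow> bool" where
  "quasi_normal_form \<Sigma> u \<longleftrightarrow> u \<in> cells1 \<Sigma> \<and>
     (\<forall>f. is_step \<Sigma> f \<and> ssrc \<Sigma> f = u \<longrightarrow> (\<exists>fs. rewr_seq \<Sigma> (stgt \<Sigma> f) fs u))"

definition quasi_normal_form_of ::
    "('v, 'e, 'r) polygraph2 \<Rightarrow> ('v, 'e) path \<Rightarrow> ('v, 'e) path \<Rightarrow> bool" where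
  "quasi_normal_form_of \<Sigma> u v \<longleftrightarrow> quasi_normal_form \<Sigma> v \<and> (\<exists>fs. rewr_seq \<Sigma> u fs v)"

definition qnf_choice ::
    "('v, 'e, 'r) polygraph2 \<Rightarrow> (('v, 'e) path \<Rightarrow> ('v, 'e) path) \<Rightarrow> bool" where
  "qnf_choice \<Sigma> q \<longleftrightarrow> (\<forall>u\<in>cells1 \<Sigma>. quasi_normal_form_of \<Sigma> u (q u)) \<and>
     (\<forall>u v. cong1 \<Sigma> u v \<longrightarrow> q u = q v)"

definition rdist :: "('v, 'e, 'r) polygraph2 \<Rightarrow> ('v, 'e) path \<Rightarrow> ('v, 'e) path \<Rightarrow> nat" where
  "rdist \<Sigma> u v = (LEAST n. \<exists>fs. rewr_seq \<Sigma> u fs v \<and> length fs = n)"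

definition qnf_label :: "('v, 'e, 'r) polygraph2 \<Rightarrow> (('v, 'e) path \<Rightarrow> ('v, 'e) path) \<Rightarrow>
    ('v, 'e, 'r) step \<Rightarrow> nat" where
  "qnf_label \<Sigma> q f = rdist \<Sigma> (stgt \<Sigma> f) (q (stgt \<Sigma> f))"


section \<open>Strict decreasingness\<close>

text \<open>\<open>lt\<close> is the well-founded strict order on the set of labels.\<close>

definition confluence_diagram :: "('v, 'e, 'r) polygraph2 \<Rightarrow> ('v, 'e, 'r) step \<Rightarrow>
    ('v, 'e, 'r) step list \<Rightarrow> ('v, 'e, 'r) step \<Rightarrow> ('v, 'e, 'r) step list \<Rightarrow> bool" where
  "confluence_diagram \<Sigma> f f' g g' \<longleftrightarrow> local_branching \<Sigma> f g \<and>
     (\<exists>x. rewr_seq \<Sigma> (ssrc \<Sigma> f) (f # f') x \<and> rewr_seq \<Sigma> (ssrc \<Sigma> g) (g # g') x)"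

definition sd_diagram :: "('v, 'e, 'r) polygraph2 \<Rightarrow> ('w \<Rightarrow> 'w \<Rightarrow> bool) \<Rightarrow>
    (('v, 'e, 'r) step \<Rightarrow> 'w) \<Rightarrow> ('v, 'e, 'r) step \<Rightarrow> ('v, 'e, 'r) step list \<Rightarrow>
    ('v, 'e, 'r) step \<Rightarrow> ('v, 'e, 'r) step list \<Rightarrow> bool" where
  "sd_diagram \<Sigma> lt \<psi> f f' g g' \<longleftrightarrow> confluence_diagram \<Sigma> f f' g g' \<and>
     (\<forall>k\<in>\<psi> ` set f'. lt k (\<psi> f)) \<and> (\<forall>k\<in>\<psi> ` set g'. lt k (\<psi> g))"

definition strictly_decreasing :: "('v, 'e, 'r) polygraph2 \<Rightarrow> ('w \<Rightarrow> 'w \<Rightarrow> bool) \<Rightarrow>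
    (('v, 'e, 'r) step \<Rightarrow> 'w) \<Rightarrow> bool" where
  "strictly_decreasing \<Sigma> lt \<psi> \<longleftrightarrow>
     (\<forall>f g. local_branching \<Sigma> f g \<longrightarrow> (\<exists>f' g'. sd_diagram \<Sigma> lt \<psi> f f' g g'))"

definition compatible_with_contexts :: "('v, 'e, 'r) polygraph2 \<Rightarrow> ('w \<Rightarrow> 'w \<Rightarrow> bool) \<Rightarrow>
    (('v, 'e, 'r) step \<Rightarrow> 'w) \<Rightarrow> bool" where
  "compatible_with_contexts \<Sigma> lt \<psi> \<longleftrightarrow>
     (\<forall>f f' g g' u1 u2. sd_diagram \<Sigma> lt \<psi> f f' g g' \<and> context_of \<Sigma> (ssrc \<Sigma> f) u1 u2 \<longrightarrow>
        sd_diagram \<Sigma> lt \<psi> (whisk u1 f u2) (map (\<lambda>h. whisk u1 h u2) f')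
          (whisk u1 g u2) (map (\<lambda>h. whisk u1 h u2) g'))"

definition peiffer_decreasing :: "('v, 'e, 'r) polygraph2 \<Rightarrow> ('w \<Rightarrow> 'w \<Rightarrow> bool) \<Rightarrow>
    (('v, 'e, 'r) step \<Rightarrow> 'w) \<Rightarrow> ('v, 'e, 'r, 'a) cells3_ext \<Rightarrow> bool" where
  "peiffer_decreasing \<Sigma> lt \<psi> \<Gamma> \<longleftrightarrow> strictly_decreasing \<Sigma> lt \<psi> \<and>
     (\<forall>f g. peiffer_pair \<Sigma> f g \<longrightarrow>
        (let u = ssrc \<Sigma> f; u' = stgt \<Sigma> f; v = ssrc \<Sigma> g; v' = stgt \<Sigma> g in
         \<exists>f' g'. sd_diagram \<Sigma> lt \<psi> (rwhisk f v) f' (lwhisk u g) g' \<and>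
           eqmod \<Sigma> \<Gamma>
             (step_cell (lwhisk u' g) \<star>\<^sub>1 Inv2 (step_cell (rwhisk f v')))
             (seq_cell \<Sigma> (u' \<bullet> v) f' \<star>\<^sub>1 Inv2 (seq_cell \<Sigma> (u \<bullet> v') g'))))"


section \<open>Loops\<close>

definition loop2 :: "('v, 'e, 'r) polygraph2 \<Rightarrow> ('v, 'e, 'r) term2 \<Rightarrow> bool" where
  "loop2 \<Sigma> f \<longleftrightarrow> f \<in> cells2 \<Sigma> \<and> src1 \<Sigma> f = tgt1 \<Sigma> f"

definition loop_rotation :: "('v, 'e, 'r) polygraph2 \<Rightarrow>
    ('v, 'e, 'r) term2 \<Rightarrow> ('v, 'e, 'r) term2 \<Rightarrow> bool" where
  "loop_rotation \<Sigma> f g \<longleftrightarrow>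
     (\<exists>u v fs gs. rewr_seq \<Sigma> u fs v \<and> rewr_seq \<Sigma> v gs u \<and>
        eq2 \<Sigma> f (seq_cell \<Sigma> u (fs @ gs)) \<and> eq2 \<Sigma> g (seq_cell \<Sigma> v (gs @ fs)))"

text \<open>
  The transitive closure is needed for \<open>equivalence class\<close> to make sense: because of the
  exchange law, a 2-loop may have several decompositions into rewriting steps, and
  \<open>loop_rotation\<close> is not transitive by definition.
\<close>

definition loop_equiv :: "('v, 'e, 'r) polygraph2 \<Rightarrow>
    ('v, 'e, 'r) term2 \<Rightarrow> ('v, 'e, 'r) term2 \<Rightarrow> bool" where
  "loop_equiv \<Sigma> = (loop_rotation \<Sigma>)\<^sup>+\<^sup>+"

definition minimal_comp1 :: "('v, 'e, 'r) polygraph2 \<Rightarrow> ('v, 'e, 'r) term2 \<Rightarrow> bool" where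
  "minimal_comp1 \<Sigma> f \<longleftrightarrow>
     (\<forall>g h k. g \<in> cells2 \<Sigma> \<and> loop2 \<Sigma> h \<and> k \<in> cells2 \<Sigma> \<and> eq2 \<Sigma> f (g \<star>\<^sub>1 h \<star>\<^sub>1 k) \<longrightarrow>
        eq2 \<Sigma> h (Id2 (src1 \<Sigma> h)) \<or> eq2 \<Sigma> h f)"

definition minimal_context :: "('v, 'e, 'r) polygraph2 \<Rightarrow> ('v, 'e, 'r) term2 \<Rightarrow> bool" where
  "minimal_context \<Sigma> f \<longleftrightarrow>
     \<not> (\<exists>u g v. u \<in> cells1 \<Sigma> \<and> v \<in> cells1 \<Sigma> \<and> \<not> is_id1 u \<and> \<not> is_id1 v \<and> loop2 \<Sigma> g \<and>
          eq2 \<Sigma> f (Id2 u \<star>\<^sub>0 g \<star>\<^sub>0 Id2 v))"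

definition elementary_loop :: "('v, 'e, 'r) polygraph2 \<Rightarrow> ('v, 'e, 'r) term2 \<Rightarrow> bool" where
  "elementary_loop \<Sigma> f \<longleftrightarrow> loop2 \<Sigma> f \<and> minimal_comp1 \<Sigma> f \<and> minimal_context \<Sigma> f"

definition loop_representatives ::
    "('v, 'e, 'r) polygraph2 \<Rightarrow> ('v, 'e, 'r) term2 set \<Rightarrow> bool" where
  "loop_representatives \<Sigma> R \<longleftrightarrow> (\<forall>\<alpha>\<in>R. elementary_loop \<Sigma> \<alpha>) \<and>
     (\<forall>f. elementary_loop \<Sigma> f \<longrightarrow> (\<exists>!\<alpha>. \<alpha> \<in> R \<and> loop_equiv \<Sigma> f \<alpha>))"

definition loop_extension ::
    "('v, 'e, 'r) polygraph2 \<Rightarrow> ('v, 'e, 'r, 'a) cells3_ext \<Rightarrow> bool" where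
  "loop_extension \<Sigma> \<Lambda> \<longleftrightarrow> globular_extension \<Sigma> \<Lambda> \<and>
     (\<exists>R A. loop_representatives \<Sigma> R \<and> bij_betw A R (gens3 \<Lambda>) \<and>
        (\<forall>\<alpha>\<in>R. eq21 \<Sigma> (gsrc \<Lambda> (A \<alpha>)) \<alpha> \<and> eq21 \<Sigma> (gtgt \<Lambda> (A \<alpha>)) (Id2 (src1 \<Sigma> \<alpha>))))"


section \<open>Squier's completion\<close>

text \<open>
  Critical branchings being unordered pairs, the generating 3-cells are indexed by the
  two-element sets \<open>{f, g}\<close>, and their direction is arbitrary.
\<close>

definition generating_sd_confluences :: "('v, 'e, 'r) polygraph2 \<Rightarrow> ('w \<Rightarrow> 'w \<Rightarrow> bool) \<Rightarrow>
    (('v, 'e, 'r) step \<Rightarrow> 'w) \<Rightarrow> ('v, 'e, 'r, 'a) cells3_ext \<Rightarrow> bool" where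
  "generating_sd_confluences \<Sigma> lt \<psi> \<O> \<longleftrightarrow> globular_extension \<Sigma> \<O> \<and>
     (\<exists>D. bij_betw D {{f, g} | f g. critical \<Sigma> f g} (gens3 \<O>) \<and>
        (\<forall>f g. critical \<Sigma> f g \<longrightarrow>
           (\<exists>f' g'. sd_diagram \<Sigma> lt \<psi> f f' g g' \<and>
              (let d = D {f, g};
                   a = seq_cell \<Sigma> (ssrc \<Sigma> f) (f # f');
                   b = seq_cell \<Sigma> (ssrc \<Sigma> g) (g # g')
               in eq21 \<Sigma> (gsrc \<O> d) a \<and> eq21 \<Sigma> (gtgt \<O> d) b \<or>
                  eq21 \<Sigma> (gsrc \<O> d) b \<and> eq21 \<Sigma> (gtgt \<O> d) a))))"

definition sd_squier_completion :: "('v, 'e, 'r) polygraph2 \<Rightarrow> ('w \<Rightarrow> 'w \<Rightarrow> bool) \<Rightarrow>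
    (('v, 'e, 'r) step \<Rightarrow> 'w) \<Rightarrow> ('v, 'e, 'r, 'a) cells3_ext \<Rightarrow> bool" where
  "sd_squier_completion \<Sigma> lt \<psi> \<Gamma> \<longleftrightarrow>
     (\<exists>O' L'. gens3 \<Gamma> = O' \<union> L' \<and>
        generating_sd_confluences \<Sigma> lt \<psi> (\<Gamma>\<lparr>gens3 := O'\<rparr>) \<and>
        loop_extension \<Sigma> (\<Gamma>\<lparr>gens3 := L'\<rparr>))"

section \<open>Consistency of the definitions\<close>

text \<open>
  Congruent terms lie in the same set of cells and are parallel, and a quasi-normal form
  labelling is always strictly decreasing, so that the first conjunct of
  \<open>peiffer_decreasing\<close> is no restriction for such labellings.
\<close>

lemma src0_pcomp [simp]: "src0 (u \<bullet> v) = src0 u"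
  by (simp add: pcomp_def)

lemma cells1_iff: "u \<in> cells1 \<Sigma> \<longleftrightarrow> pre_digraph.awalk (graph \<Sigma>) (src0 u) (edges u) (tgt0 \<Sigma> u)"
proof -
  interpret pre_digraph "graph \<Sigma>" .
  have "cas x p y \<Longrightarrow> awlast x p = y" for x p y
    by (induct x p y rule: cas.induct) auto
  then show ?thesis by (auto simp: cells1_def tgt0_def awalk_def)
qed

context
  fixes \<Sigma> :: "('v, 'e, 'r) polygraph2"
  assumes P: "two_polygraph \<Sigma>"
begin

interpretation wf_digraph "graph \<Sigma>" using P by (simp add: two_polygraph_def)

lemma tgt0_id1 [simp]: "tgt0 \<Sigma> (id1 x) = x"
  by (simp add: tgt0_def id1_def)

lemma tgt0_in: "u \<in> cells1 \<Sigma> \<Longrightarrow> tgt0 \<Sigma> u \<in> verts (graph \<Sigma>)"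
  by (auto simp: cells1_iff)

lemma src0_in: "u \<in> cells1 \<Sigma> \<Longrightarrow> src0 u \<in> verts (graph \<Sigma>)"
  by (auto simp: cells1_iff)

lemma tgt0_pcomp:
  "u \<in> cells1 \<Sigma> \<Longrightarrow> v \<in> cells1 \<Sigma> \<Longrightarrow> tgt0 \<Sigma> u = src0 v \<Longrightarrow> tgt0 \<Sigma> (u \<bullet> v) = tgt0 \<Sigma> v"
  by (cases "edges v = []") (auto simp: tgt0_def pcomp_def id1_def awalk_verts_conv)

lemma cells1_pcomp:
  "u \<in> cells1 \<Sigma> \<Longrightarrow> v \<in> cells1 \<Sigma> \<Longrightarrow> tgt0 \<Sigma> u = src0 v \<Longrightarrow> u \<bullet> v \<in> cells1 \<Sigma>"
  using tgt0_pcomp[of u v] unfolding cells1_iff by (auto simp: pcomp_def)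

lemma id1_in: "x \<in> verts (graph \<Sigma>) \<Longrightarrow> id1 x \<in> cells1 \<Sigma>"
  unfolding cells1_iff by (simp add: id1_def tgt0_def awalk_def)

lemma typed2_boundary:
  "typed2 \<Sigma> f \<Longrightarrow> src1 \<Sigma> f \<in> cells1 \<Sigma> \<and> tgt1 \<Sigma> f \<in> cells1 \<Sigma> \<and>
    src0 (src1 \<Sigma> f) = src0 (tgt1 \<Sigma> f) \<and> tgt0 \<Sigma> (src1 \<Sigma> f) = tgt0 \<Sigma> (tgt1 \<Sigma> f)"
proof (induction f)
  case (Gen2 x)
  then show ?case using P by (auto simp: two_polygraph_def)
qed (auto simp: tgt0_pcomp cells1_pcomp)

lemma src0_id1 [simp]: "src0 (id1 x) = x"
  by (simp add: id1_def)

lemma pcomp_assoc: "(u \<bullet> v) \<bullet> w = u \<bullet> v \<bullet> w"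
  by (simp add: pcomp_def)

lemma id1_pcomp: "id1 (src0 u) \<bullet> u = u"
  by (simp add: pcomp_def id1_def)

lemma pcomp_id1: "u \<bullet> id1 x = u"
  by (simp add: pcomp_def id1_def)

lemma cong2_boundary:
  assumes "cong2 \<Sigma> T R f g" "T = cells21 \<Sigma> \<or> T = cells2 \<Sigma>"
    "\<And>f g. (f, g) \<in> R \<Longrightarrow> f \<in> T \<and> g \<in> T \<and> src1 \<Sigma> f = src1 \<Sigma> g \<and> tgt1 \<Sigma> f = tgt1 \<Sigma> g"
  shows "f \<in> T \<and> g \<in> T \<and> src1 \<Sigma> f = src1 \<Sigma> g \<and> tgt1 \<Sigma> f = tgt1 \<Sigma> g"
  using assms
  by (induction rule: cong2.induct)
    (auto simp: cells21_def cells2_def pcomp_assoc id1_pcomp pcomp_id1 tgt0_pcomp typed2_boundary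
      cells1_pcomp src0_in tgt0_in id1_in)

lemma rewr_in: "rewr_seq \<Sigma> u fs v \<Longrightarrow> v \<in> cells1 \<Sigma>"
  by (induction fs arbitrary: u) auto

lemma rsrc_in: "r \<in> rules \<Sigma> \<Longrightarrow> rsrc \<Sigma> r \<in> cells1 \<Sigma> \<and> rtgt \<Sigma> r \<in> cells1 \<Sigma> \<and> 
  src0 (rsrc \<Sigma> r) = src0 (rtgt \<Sigma> r) \<and> tgt0 \<Sigma> (rsrc \<Sigma> r) = tgt0 \<Sigma> (rtgt \<Sigma> r)"
  using P by (auto simp: two_polygraph_def)

lemma step_in: "is_step \<Sigma> f \<Longrightarrow> ssrc \<Sigma> f \<in> cells1 \<Sigma> \<and> stgt \<Sigma> f \<in> cells1 \<Sigma>"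
  using rsrc_in by (cases f) (auto intro!: cells1_pcomp simp: tgt0_pcomp)

lemma step_cong: "is_step \<Sigma> f \<Longrightarrow> cong1 \<Sigma> (ssrc \<Sigma> f) (stgt \<Sigma> f)"
  using rsrc_in by (cases f) (auto intro!: cong1.comp cong1.refl cong1.rule simp: tgt0_pcomp)

lemma rdist_decr:
  assumes "rewr_seq \<Sigma> u fs v"  "length fs = rdist \<Sigma> u v"
  shows "\<forall>f\<in>set fs. rdist \<Sigma> (stgt \<Sigma> f) v < rdist \<Sigma> u v"
  using assms
proof (induction fs arbitrary: u)
  case (Cons f fs)
  have s: "rewr_seq \<Sigma> (stgt \<Sigma> f) fs v" and f: "is_step \<Sigma> f" "ssrc \<Sigma> f = u" using Cons by auto
  have le: "rdist \<Sigma> (stgt \<Sigma> f) v \<le> length fs"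
    unfolding rdist_def by (rule Least_le) (use s in blast)
  obtain gs where gs: "rewr_seq \<Sigma> (stgt \<Sigma> f) gs v" "length gs = rdist \<Sigma> (stgt \<Sigma> f) v"
    unfolding rdist_def using LeastI_ex[of "\<lambda>n. \<exists>gs. rewr_seq \<Sigma> (stgt \<Sigma> f) gs v \<and> length gs = n"] s by blast
  have "rdist \<Sigma> u v \<le> length (f # gs)"
    unfolding rdist_def by (rule Least_le) (use gs f in \<open>auto intro!: exI[of _ "f # gs"]\<close>)
  then have e: "length fs = rdist \<Sigma> (stgt \<Sigma> f) v" using le gs Cons.prems by simp
  have "\<forall>g\<in>set fs. rdist \<Sigma> (stgt \<Sigma> g) v < rdist \<Sigma> (stgt \<Sigma> f) v" by (rule Cons.IH[OF s e])
  then show ?case using e Cons.prems by (auto dest: less_trans) 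
qed simp

lemma rewr_cong: "rewr_seq \<Sigma> u fs v \<Longrightarrow> f \<in> set fs \<Longrightarrow> cong1 \<Sigma> u (stgt \<Sigma> f)"
  by (induction fs arbitrary: u) (auto intro: step_cong cong1.trans)

lemma qnf_label_strictly_decreasing:
  assumes q: "qnf_choice \<Sigma> q"
  shows "strictly_decreasing \<Sigma> (<) (qnf_label \<Sigma> q)"
proof -
  have path: "\<exists>fs. rewr_seq \<Sigma> (stgt \<Sigma> f) fs (q (ssrc \<Sigma> f)) \<and>
      (\<forall>k\<in>qnf_label \<Sigma> q ` set fs. k < qnf_label \<Sigma> q f)" if f: "is_step \<Sigma> f" for f
  proof -
    let ?v = "stgt \<Sigma> f"
    have "\<exists>fs. rewr_seq \<Sigma> ?v fs (q ?v)"
      using q step_in[OF f] by (auto simp: qnf_choice_def quasi_normal_form_of_def)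
    then obtain fs where fs: "rewr_seq \<Sigma> ?v fs (q ?v)" "length fs = rdist \<Sigma> ?v (q ?v)"
      unfolding rdist_def
      using LeastI_ex[of "\<lambda>n. \<exists>gs. rewr_seq \<Sigma> ?v gs (q ?v) \<and> length gs = n"] by blast
    have "q ?v = q (ssrc \<Sigma> f)" using q step_cong[OF f] by (auto simp: qnf_choice_def)
    moreover have "q (stgt \<Sigma> g) = q ?v" if "g \<in> set fs" for g
      using q rewr_cong[OF fs(1) that] by (auto simp: qnf_choice_def)
    ultimately show ?thesis using rdist_decr[OF fs] fs(1) by (auto simp: qnf_label_def)
  qed
  show ?thesis unfolding strictly_decreasing_def
  proof (intro allI impI)
    fix f g assume l: "local_branching \<Sigma> f g"
    then obtain f' g' where "rewr_seq \<Sigma> (stgt \<Sigma> f) f' (q (ssrc \<Sigma> f)) \<and>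
      (\<forall>k\<in>qnf_label \<Sigma> q ` set f'. k < qnf_label \<Sigma> q f)"
      "rewr_seq \<Sigma> (stgt \<Sigma> g) g' (q (ssrc \<Sigma> g)) \<and>
      (\<forall>k\<in>qnf_label \<Sigma> q ` set g'. k < qnf_label \<Sigma> q g)"
      using path by (meson local_branching_def)
    then show "\<exists>f' g'. sd_diagram \<Sigma> (<) (qnf_label \<Sigma> q) f f' g g'"
      using l by (auto simp: sd_diagram_def confluence_diagram_def local_branching_def)
  qed
qed

end

end

(* Concatenating first steps of shortest rewriting sequences gives a path from every 1-cell u to its
   quasi-normal form.  Modulo the extension, a rewriting step f from u to v followed by the path of v
   equals the path of u, by induction on the label of f: if u is its own quasi-normal form, this is a
   2-loop, which splits into elementary loops up to contexts and rotations; otherwise f and the first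
   step of the path of u form a local branching, and the remaining steps of its strictly decreasing
   diagram have smaller labels.  By induction on terms, every 2-cell from u to v composed with the
   path of v equals the path of u, so parallel 2-cells are equal modulo the extension. *)
theory Submission
  imports Defs
begin

section \<open>Calculus of 2-cells modulo a set of relations\<close>

text \<open>That order says nothing about a step leaving a 1-cell which is its own quasi-normal
  form, and only there do the loop 3-cells enter. The equation around a local branching needs a
  single diagram that is both strictly decreasing, for the induction, and commutative modulo the
  extension. Critical branchings have one by their generating 3-cell, and overlapping ones inherit
  it by whiskering, which is where compatibility with contexts is used. For a Peiffer branching the
  exchange square commutes but need not be strictly decreasing; Peiffer decreasingness provides a
  diagram that is, related to the square modulo the extension.\<close>

locale presented_21_category =
  fixes \<Sigma> :: "('v, 'e, 'r) polygraph2"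
    and R :: "('v, 'e, 'r) term2 rel"
  assumes polygraph: "two_polygraph \<Sigma>"
    and parallel_R: "(f, g) \<in> R \<Longrightarrow> f \<in> cells21 \<Sigma> \<and> g \<in> cells21 \<Sigma> \<and>
      src1 \<Sigma> f = src1 \<Sigma> g \<and> tgt1 \<Sigma> f = tgt1 \<Sigma> g"
begin

text \<open>\<open>R\<close> stays arbitrary because the calculus is used twice: with the boundaries
  of the 3-cells of \<open>\<Gamma>\<close>, and with the empty set, where \<open>\<approx>\<close>
  is equality in the free (2,1)-category.\<close>

abbreviation eqR (infix \<open>\<approx>\<close> 50) where
  "f \<approx> g \<equiv> cong2 \<Sigma> (cells21 \<Sigma>) R f g"

declare cong2.trans [trans]

lemma boundary [simp]:
  assumes "typed2 \<Sigma> f"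
  shows "src1 \<Sigma> f \<in> cells1 \<Sigma>" "tgt1 \<Sigma> f \<in> cells1 \<Sigma>"
    "src0 (tgt1 \<Sigma> f) = src0 (src1 \<Sigma> f)" "tgt0 \<Sigma> (tgt1 \<Sigma> f) = tgt0 \<Sigma> (src1 \<Sigma> f)"
  using typed2_boundary[OF polygraph assms] by auto

lemmas pcomp_simps [simp] = tgt0_pcomp[OF polygraph] cells1_pcomp[OF polygraph]
  pcomp_assoc[OF polygraph] pcomp_id1[OF polygraph] id1_pcomp[OF polygraph] src0_id1[OF polygraph]
  tgt0_id1[OF polygraph]

lemma eqR_boundary:
  assumes "f \<approx> g"
  shows "typed2 \<Sigma> f" "typed2 \<Sigma> g" "src1 \<Sigma> f = src1 \<Sigma> g" "tgt1 \<Sigma> f = tgt1 \<Sigma> g"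
proof -
  have "f \<in> cells21 \<Sigma> \<and> g \<in> cells21 \<Sigma> \<and> src1 \<Sigma> f = src1 \<Sigma> g \<and> tgt1 \<Sigma> f = tgt1 \<Sigma> g"
    by (rule cong2_boundary[OF polygraph assms]) (rule disjI1[OF HOL.refl], rule parallel_R)
  then show "typed2 \<Sigma> f" "typed2 \<Sigma> g" "src1 \<Sigma> f = src1 \<Sigma> g" "tgt1 \<Sigma> f = tgt1 \<Sigma> g"
    by (auto simp: cells21_def)
qed

lemma eqR_refl: "typed2 \<Sigma> f \<Longrightarrow> f \<approx> f"
  by (simp add: cong2.refl cells21_def)

lemma eqR_comp0:
  assumes "f \<approx> f'" "g \<approx> g'" "tgt0 \<Sigma> (src1 \<Sigma> f) = src0 (src1 \<Sigma> g)"
  shows "f \<star>\<^sub>0 g \<approx> f' \<star>\<^sub>0 g'"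
  using assms(3) eqR_boundary(1)[OF assms(1)] eqR_boundary(1)[OF assms(2)]
  by (intro cong2.comp0 assms) (simp add: cells21_def)

lemma eqR_comp1:
  assumes "f \<approx> f'" "g \<approx> g'" "tgt1 \<Sigma> f = src1 \<Sigma> g"
  shows "f \<star>\<^sub>1 g \<approx> f' \<star>\<^sub>1 g'"
  using assms(3) eqR_boundary(1)[OF assms(1)] eqR_boundary(1)[OF assms(2)]
  by (intro cong2.comp1 assms) (simp add: cells21_def)

lemma eqR_assoc1: "typed2 \<Sigma> ((f \<star>\<^sub>1 g) \<star>\<^sub>1 h) \<Longrightarrow> (f \<star>\<^sub>1 g) \<star>\<^sub>1 h \<approx> f \<star>\<^sub>1 g \<star>\<^sub>1 h"
  by (rule cong2.assoc1) (simp add: cells21_def)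

lemma eqR_assoc0: "typed2 \<Sigma> ((f \<star>\<^sub>0 g) \<star>\<^sub>0 h) \<Longrightarrow> (f \<star>\<^sub>0 g) \<star>\<^sub>0 h \<approx> f \<star>\<^sub>0 g \<star>\<^sub>0 h"
  by (rule cong2.assoc0) (simp add: cells21_def)

lemma eqR_unit_left: "typed2 \<Sigma> f \<Longrightarrow> src1 \<Sigma> f = u \<Longrightarrow> Id2 u \<star>\<^sub>1 f \<approx> f"
  using cong2.unit1_left[of f "cells21 \<Sigma>"] by (auto simp: cells21_def)

lemma eqR_unit_right: "typed2 \<Sigma> f \<Longrightarrow> tgt1 \<Sigma> f = u \<Longrightarrow> f \<star>\<^sub>1 Id2 u \<approx> f"
  using cong2.unit1_right[of f "cells21 \<Sigma>"] by (auto simp: cells21_def)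

lemma eqR_inv_right: "typed2 \<Sigma> f \<Longrightarrow> f \<star>\<^sub>1 Inv2 f \<approx> Id2 (src1 \<Sigma> f)"
  by (rule cong2.inv_right) (simp add: cells21_def)

lemma eqR_inv_left: "typed2 \<Sigma> f \<Longrightarrow> Inv2 f \<star>\<^sub>1 f \<approx> Id2 (tgt1 \<Sigma> f)"
  by (rule cong2.inv_left) (simp add: cells21_def)

lemma eqR_id_comp0:
  "u \<in> cells1 \<Sigma> \<Longrightarrow> v \<in> cells1 \<Sigma> \<Longrightarrow> tgt0 \<Sigma> u = src0 v \<Longrightarrow> Id2 u \<star>\<^sub>0 Id2 v \<approx> Id2 (u \<bullet> v)"
  by (rule cong2.id_comp0) (simp add: cells21_def)

lemma eqR_exchange:
  assumes "typed2 \<Sigma> (f \<star>\<^sub>1 f')" "typed2 \<Sigma> (g \<star>\<^sub>1 g')" "tgt0 \<Sigma> (src1 \<Sigma> f) = src0 (src1 \<Sigma> g)"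
  shows "(f \<star>\<^sub>1 f') \<star>\<^sub>0 (g \<star>\<^sub>1 g') \<approx> (f \<star>\<^sub>0 g) \<star>\<^sub>1 (f' \<star>\<^sub>0 g')"
  by (rule cong2.exchange) (use assms in \<open>simp add: cells21_def\<close>)

text \<open>All 2-cells are invertible, so composing with \<open>Inv2 h\<close> removes a common
  tail \<open>h\<close>.\<close>

lemma cancel_right:
  assumes "f \<star>\<^sub>1 h \<approx> g \<star>\<^sub>1 h"
  shows "f \<approx> g"
proof -
  have *: "k \<approx> (k \<star>\<^sub>1 h) \<star>\<^sub>1 Inv2 h" if "typed2 \<Sigma> (k \<star>\<^sub>1 h)" for k
  proof -
    have "(k \<star>\<^sub>1 h) \<star>\<^sub>1 Inv2 h \<approx> k \<star>\<^sub>1 h \<star>\<^sub>1 Inv2 h"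
      using that by (intro eqR_assoc1) auto
    also have "\<dots> \<approx> k \<star>\<^sub>1 Id2 (src1 \<Sigma> h)"
      using that by (intro eqR_comp1 eqR_refl eqR_inv_right) auto
    also have "\<dots> \<approx> k"
      using that by (intro eqR_unit_right) auto
    finally show ?thesis by (rule cong2.sym)
  qed
  have t: "typed2 \<Sigma> (f \<star>\<^sub>1 h)" "typed2 \<Sigma> (g \<star>\<^sub>1 h)"
    using eqR_boundary[OF assms] by auto
  have "f \<approx> (f \<star>\<^sub>1 h) \<star>\<^sub>1 Inv2 h" by (rule *[OF t(1)])
  also have "\<dots> \<approx> (g \<star>\<^sub>1 h) \<star>\<^sub>1 Inv2 h"
    using t by (intro eqR_comp1 assms eqR_refl) auto
  also have "\<dots> \<approx> g" by (rule cong2.sym[OF *[OF t(2)]])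
  finally show ?thesis .
qed

section \<open>Whiskering and the two decompositions of a horizontal composite\<close>

lemma comp1_boundary0:
  assumes "typed2 \<Sigma> (f \<star>\<^sub>1 g)"
  shows "src0 (src1 \<Sigma> g) = src0 (src1 \<Sigma> f)" "tgt0 \<Sigma> (src1 \<Sigma> g) = tgt0 \<Sigma> (src1 \<Sigma> f)"
  using assms boundary(3,4)[of f] by auto

text \<open>The exchange law applies once \<open>Id2 w\<close> is split into
  \<open>Id2 w \<star>\<^sub>1 Id2 w\<close>.\<close>

lemma left_whisker_comp1:
  assumes "typed2 \<Sigma> (f \<star>\<^sub>1 g)" "w \<in> cells1 \<Sigma>" "tgt0 \<Sigma> w = src0 (src1 \<Sigma> f)"
  shows "Id2 w \<star>\<^sub>0 (f \<star>\<^sub>1 g) \<approx> (Id2 w \<star>\<^sub>0 f) \<star>\<^sub>1 (Id2 w \<star>\<^sub>0 g)"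
proof -
  have "Id2 w \<star>\<^sub>0 (f \<star>\<^sub>1 g) \<approx> (Id2 w \<star>\<^sub>1 Id2 w) \<star>\<^sub>0 (f \<star>\<^sub>1 g)"
    using assms by (intro eqR_comp0 eqR_refl cong2.sym[OF eqR_unit_left]) auto
  also have "\<dots> \<approx> (Id2 w \<star>\<^sub>0 f) \<star>\<^sub>1 (Id2 w \<star>\<^sub>0 g)"
    using assms by (intro eqR_exchange) auto
  finally show ?thesis .
qed

lemma right_whisker_comp1:
  assumes "typed2 \<Sigma> (f \<star>\<^sub>1 g)" "w \<in> cells1 \<Sigma>" "tgt0 \<Sigma> (src1 \<Sigma> f) = src0 w"
  shows "(f \<star>\<^sub>1 g) \<star>\<^sub>0 Id2 w \<approx> (f \<star>\<^sub>0 Id2 w) \<star>\<^sub>1 (g \<star>\<^sub>0 Id2 w)"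
proof -
  have "(f \<star>\<^sub>1 g) \<star>\<^sub>0 Id2 w \<approx> (f \<star>\<^sub>1 g) \<star>\<^sub>0 (Id2 w \<star>\<^sub>1 Id2 w)"
    using assms by (intro eqR_comp0 eqR_refl cong2.sym[OF eqR_unit_left]) auto
  also have "\<dots> \<approx> (f \<star>\<^sub>0 Id2 w) \<star>\<^sub>1 (g \<star>\<^sub>0 Id2 w)"
    using assms by (intro eqR_exchange) auto
  finally show ?thesis .
qed

lemma left_whisker_left_whisker:
  assumes "typed2 \<Sigma> f" "v \<in> cells1 \<Sigma>" "w \<in> cells1 \<Sigma>" "tgt0 \<Sigma> v = src0 (src1 \<Sigma> f)" "tgt0 \<Sigma> w = src0 v"
  shows "Id2 w \<star>\<^sub>0 Id2 v \<star>\<^sub>0 f \<approx> Id2 (w \<bullet> v) \<star>\<^sub>0 f"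
proof -
  have "Id2 (w \<bullet> v) \<star>\<^sub>0 f \<approx> (Id2 w \<star>\<^sub>0 Id2 v) \<star>\<^sub>0 f"
    using assms by (intro eqR_comp0 eqR_refl cong2.sym[OF eqR_id_comp0]) auto
  also have "\<dots> \<approx> Id2 w \<star>\<^sub>0 Id2 v \<star>\<^sub>0 f"
    using assms by (intro eqR_assoc0) auto
  finally show ?thesis by (rule cong2.sym)
qed

lemma right_whisker_right_whisker:
  assumes "typed2 \<Sigma> f" "v \<in> cells1 \<Sigma>" "w \<in> cells1 \<Sigma>" "tgt0 \<Sigma> (src1 \<Sigma> f) = src0 v" "tgt0 \<Sigma> v = src0 w"
  shows "(f \<star>\<^sub>0 Id2 v) \<star>\<^sub>0 Id2 w \<approx> f \<star>\<^sub>0 Id2 (v \<bullet> w)"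
proof -
  have "(f \<star>\<^sub>0 Id2 v) \<star>\<^sub>0 Id2 w \<approx> f \<star>\<^sub>0 Id2 v \<star>\<^sub>0 Id2 w"
    using assms by (intro eqR_assoc0) auto
  also have "\<dots> \<approx> f \<star>\<^sub>0 Id2 (v \<bullet> w)"
    using assms by (intro eqR_comp0 eqR_refl eqR_id_comp0) auto
  finally show ?thesis .
qed

text \<open>Identities inserted after \<open>f\<close> and before \<open>g\<close> make the exchange
  law applicable. Inserting them the other way round gives the next lemma; together they are the
  commuting square of two independent 2-cells.\<close>

lemma comp0_eq_right_left:
  assumes "typed2 \<Sigma> (f \<star>\<^sub>0 g)"
  shows "f \<star>\<^sub>0 g \<approx> (f \<star>\<^sub>0 Id2 (src1 \<Sigma> g)) \<star>\<^sub>1 (Id2 (tgt1 \<Sigma> f) \<star>\<^sub>0 g)"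
proof -
  have "f \<star>\<^sub>0 g \<approx> (f \<star>\<^sub>1 Id2 (tgt1 \<Sigma> f)) \<star>\<^sub>0 (Id2 (src1 \<Sigma> g) \<star>\<^sub>1 g)"
    using assms by (intro eqR_comp0 cong2.sym[OF eqR_unit_left] cong2.sym[OF eqR_unit_right]) auto
  also have "\<dots> \<approx> (f \<star>\<^sub>0 Id2 (src1 \<Sigma> g)) \<star>\<^sub>1 (Id2 (tgt1 \<Sigma> f) \<star>\<^sub>0 g)"
    using assms by (intro eqR_exchange) auto
  finally show ?thesis .
qed

lemma comp0_eq_left_right:
  assumes "typed2 \<Sigma> (f \<star>\<^sub>0 g)"
  shows "f \<star>\<^sub>0 g \<approx> (Id2 (src1 \<Sigma> f) \<star>\<^sub>0 g) \<star>\<^sub>1 (f \<star>\<^sub>0 Id2 (tgt1 \<Sigma> g))"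
proof -
  have "f \<star>\<^sub>0 g \<approx> (Id2 (src1 \<Sigma> f) \<star>\<^sub>1 f) \<star>\<^sub>0 (g \<star>\<^sub>1 Id2 (tgt1 \<Sigma> g))"
    using assms by (intro eqR_comp0 cong2.sym[OF eqR_unit_left] cong2.sym[OF eqR_unit_right]) auto
  also have "\<dots> \<approx> (Id2 (src1 \<Sigma> f) \<star>\<^sub>0 g) \<star>\<^sub>1 (f \<star>\<^sub>0 Id2 (tgt1 \<Sigma> g))"
    using assms by (intro eqR_exchange) auto
  finally show ?thesis .
qed

text \<open>The bracketing is that of \<open>step_cell\<close>, so that whiskering a generator gives
  the cell of a rewriting step on the nose.\<close>

definition whisker :: "('v, 'e) path \<Rightarrow> ('v, 'e, 'r) term2 \<Rightarrow> ('v, 'e) path \<Rightarrow> ('v, 'e, 'r) term2"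
  where "whisker w f w' = Id2 w \<star>\<^sub>0 f \<star>\<^sub>0 Id2 w'"

lemma whisker_boundary [simp]:
  "src1 \<Sigma> (whisker w f w') = w \<bullet> src1 \<Sigma> f \<bullet> w'"
  "tgt1 \<Sigma> (whisker w f w') = w \<bullet> tgt1 \<Sigma> f \<bullet> w'"
  by (simp_all add: whisker_def)

lemma typed2_whisker [simp]:
  "typed2 \<Sigma> f \<Longrightarrow> context_of \<Sigma> (src1 \<Sigma> f) w w' \<Longrightarrow> typed2 \<Sigma> (whisker w f w')"
  by (simp add: whisker_def context_of_def)

lemma whisker_cong:
  assumes "f \<approx> g" "context_of \<Sigma> (src1 \<Sigma> f) w w'"
  shows "whisker w f w' \<approx> whisker w g w'"
  unfolding whisker_def using assms(2) eqR_boundary(1,3)[OF assms(1)]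
  by (intro eqR_comp0 assms(1) eqR_refl) (auto simp: context_of_def)

lemma whisker_comp1:
  assumes "typed2 \<Sigma> (f \<star>\<^sub>1 g)" "context_of \<Sigma> (src1 \<Sigma> f) w w'"
  shows "whisker w (f \<star>\<^sub>1 g) w' \<approx> whisker w f w' \<star>\<^sub>1 whisker w g w'"
proof -
  have "Id2 w \<star>\<^sub>0 (f \<star>\<^sub>1 g) \<star>\<^sub>0 Id2 w' \<approx> Id2 w \<star>\<^sub>0 ((f \<star>\<^sub>0 Id2 w') \<star>\<^sub>1 (g \<star>\<^sub>0 Id2 w'))"
    using assms by (intro eqR_comp0 eqR_refl right_whisker_comp1) (auto simp: context_of_def)
  also have "\<dots> \<approx> (Id2 w \<star>\<^sub>0 f \<star>\<^sub>0 Id2 w') \<star>\<^sub>1 (Id2 w \<star>\<^sub>0 g \<star>\<^sub>0 Id2 w')"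
    using assms comp1_boundary0[OF assms(1)]
    by (intro left_whisker_comp1) (auto simp: context_of_def)
  finally show ?thesis by (simp only: whisker_def)
qed

lemma whisker_id2:
  assumes "u \<in> cells1 \<Sigma>" "context_of \<Sigma> u w w'"
  shows "whisker w (Id2 u) w' \<approx> Id2 (w \<bullet> u \<bullet> w')"
proof -
  have "Id2 w \<star>\<^sub>0 Id2 u \<star>\<^sub>0 Id2 w' \<approx> Id2 w \<star>\<^sub>0 Id2 (u \<bullet> w')"
    using assms by (intro eqR_comp0 eqR_refl eqR_id_comp0) (auto simp: context_of_def)
  also have "\<dots> \<approx> Id2 (w \<bullet> u \<bullet> w')"
    using assms by (intro eqR_id_comp0) (auto simp: context_of_def)
  finally show ?thesis by (simp only: whisker_def)
qed

lemma whisker_right_whisker: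
  assumes "typed2 \<Sigma> f" "v \<in> cells1 \<Sigma>" "tgt0 \<Sigma> (src1 \<Sigma> f) = src0 v"
    "context_of \<Sigma> (src1 \<Sigma> f \<bullet> v) w w'"
  shows "whisker w (f \<star>\<^sub>0 Id2 v) w' \<approx> whisker w f (v \<bullet> w')"
  unfolding whisker_def using assms
  by (intro eqR_comp0 eqR_refl right_whisker_right_whisker) (auto simp: context_of_def)

lemma whisker_left_whisker:
  assumes "typed2 \<Sigma> f" "v \<in> cells1 \<Sigma>" "tgt0 \<Sigma> v = src0 (src1 \<Sigma> f)"
    "context_of \<Sigma> (v \<bullet> src1 \<Sigma> f) w w'"
  shows "whisker w (Id2 v \<star>\<^sub>0 f) w' \<approx> whisker (w \<bullet> v) f w'"
proof -
  have "Id2 w \<star>\<^sub>0 (Id2 v \<star>\<^sub>0 f) \<star>\<^sub>0 Id2 w' \<approx> Id2 w \<star>\<^sub>0 Id2 v \<star>\<^sub>0 f \<star>\<^sub>0 Id2 w'"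
    using assms by (intro eqR_comp0 eqR_refl eqR_assoc0) (auto simp: context_of_def)
  also have "\<dots> \<approx> Id2 (w \<bullet> v) \<star>\<^sub>0 f \<star>\<^sub>0 Id2 w'"
    using assms by (intro left_whisker_left_whisker) (auto simp: context_of_def)
  finally show ?thesis by (simp only: whisker_def)
qed

text \<open>This trades \<open>\<star>\<^sub>0\<close> for \<open>\<star>\<^sub>1\<close> at the
  cost of larger contexts, so that an induction over terms only has to handle vertical
  composition.\<close>

lemma whisker_comp0:
  assumes "typed2 \<Sigma> (f \<star>\<^sub>0 g)" "context_of \<Sigma> (src1 \<Sigma> (f \<star>\<^sub>0 g)) w w'"
  shows "whisker w (f \<star>\<^sub>0 g) w' \<approx> whisker w f (src1 \<Sigma> g \<bullet> w') \<star>\<^sub>1 whisker (w \<bullet> tgt1 \<Sigma> f) g w'"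
proof -
  have "whisker w (f \<star>\<^sub>0 g) w' \<approx>
      whisker w ((f \<star>\<^sub>0 Id2 (src1 \<Sigma> g)) \<star>\<^sub>1 (Id2 (tgt1 \<Sigma> f) \<star>\<^sub>0 g)) w'"
    using assms by (intro whisker_cong comp0_eq_right_left)
  also have "\<dots> \<approx> whisker w (f \<star>\<^sub>0 Id2 (src1 \<Sigma> g)) w' \<star>\<^sub>1 whisker w (Id2 (tgt1 \<Sigma> f) \<star>\<^sub>0 g) w'"
    using assms by (intro whisker_comp1) auto
  also have "\<dots> \<approx> whisker w f (src1 \<Sigma> g \<bullet> w') \<star>\<^sub>1 whisker (w \<bullet> tgt1 \<Sigma> f) g w'"
    using assms by (intro eqR_comp1 whisker_right_whisker whisker_left_whisker)
      (auto simp: context_of_def)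
  finally show ?thesis .
qed

lemma whisker_id1:
  assumes "typed2 \<Sigma> f"
  shows "whisker (id1 (src0 (src1 \<Sigma> f))) f (id1 (tgt0 \<Sigma> (src1 \<Sigma> f))) \<approx> f"
proof -
  let ?v = "id1 (tgt0 \<Sigma> (src1 \<Sigma> f))"
  have r: "f \<star>\<^sub>0 Id2 ?v \<approx> f"
    using assms by (intro cong2.unit0_right) (simp add: cells21_def)
  have "Id2 (id1 (src0 (src1 \<Sigma> f))) \<star>\<^sub>0 f \<star>\<^sub>0 Id2 ?v \<approx> Id2 (id1 (src0 (src1 \<Sigma> f))) \<star>\<^sub>0 f"
    using assms id1_in[OF polygraph] src0_in[OF polygraph]
    by (intro eqR_comp0 eqR_refl r) auto
  also have "\<dots> \<approx> f"
    using assms by (intro cong2.unit0_left) (simp add: cells21_def)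
  finally show ?thesis by (simp only: whisker_def)
qed


section \<open>Rewriting steps and rewriting sequences as 2-cells\<close>

lemma step_cell_boundary [simp]:
  "src1 \<Sigma> (step_cell f) = ssrc \<Sigma> f" "tgt1 \<Sigma> (step_cell f) = stgt \<Sigma> f"
  by (cases f; simp)+

lemma rule_boundary [simp]:
  assumes "\<phi> \<in> rules \<Sigma>"
  shows "rsrc \<Sigma> \<phi> \<in> cells1 \<Sigma>" "rtgt \<Sigma> \<phi> \<in> cells1 \<Sigma>" "src0 (rtgt \<Sigma> \<phi>) = src0 (rsrc \<Sigma> \<phi>)"
    "tgt0 \<Sigma> (rtgt \<Sigma> \<phi>) = tgt0 \<Sigma> (rsrc \<Sigma> \<phi>)"
  using rsrc_in[OF polygraph assms] by auto

lemma typed2_step_cell [simp]: "is_step \<Sigma> f \<Longrightarrow> typed2 \<Sigma> (step_cell f)"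
  by (cases f) auto

lemma step_boundary [simp]:
  assumes "is_step \<Sigma> f"
  shows "ssrc \<Sigma> f \<in> cells1 \<Sigma>" "stgt \<Sigma> f \<in> cells1 \<Sigma>"
    "src0 (stgt \<Sigma> f) = src0 (ssrc \<Sigma> f)" "tgt0 \<Sigma> (stgt \<Sigma> f) = tgt0 \<Sigma> (ssrc \<Sigma> f)"
  using boundary[OF typed2_step_cell[OF assms]] by auto

lemma whisk_boundary [simp]:
  "ssrc \<Sigma> (whisk w f w') = w \<bullet> ssrc \<Sigma> f \<bullet> w'" "stgt \<Sigma> (whisk w f w') = w \<bullet> stgt \<Sigma> f \<bullet> w'"
  by (cases f; simp add: whisk_def)+

lemma is_step_whisk: "is_step \<Sigma> f \<Longrightarrow> context_of \<Sigma> (ssrc \<Sigma> f) w w' \<Longrightarrow> is_step \<Sigma> (whisk w f w')"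
  by (cases f) (auto simp: whisk_def context_of_def)

lemma whisker_step_cell:
  assumes "is_step \<Sigma> f" "context_of \<Sigma> (ssrc \<Sigma> f) w w'"
  shows "whisker w (step_cell f) w' \<approx> step_cell (whisk w f w')"
proof (cases f)
  case (Step u \<phi> v)
  have "whisker w (Id2 u \<star>\<^sub>0 Gen2 \<phi> \<star>\<^sub>0 Id2 v) w' \<approx> whisker (w \<bullet> u) (Gen2 \<phi> \<star>\<^sub>0 Id2 v) w'"
    using assms Step by (intro whisker_left_whisker) (auto simp: context_of_def)
  also have "\<dots> \<approx> whisker (w \<bullet> u) (Gen2 \<phi>) (v \<bullet> w')"
    using assms Step by (intro whisker_right_whisker) (auto simp: context_of_def)
  finally show ?thesis
    using Step by (simp add: whisk_def whisker_def)
qed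

lemma step_cell_rwhisk:
  assumes "is_step \<Sigma> f" "v \<in> cells1 \<Sigma>" "tgt0 \<Sigma> (ssrc \<Sigma> f) = src0 v"
  shows "step_cell f \<star>\<^sub>0 Id2 v \<approx> step_cell (rwhisk f v)"
proof (cases f)
  case (Step a \<phi> b)
  have "(Id2 a \<star>\<^sub>0 Gen2 \<phi> \<star>\<^sub>0 Id2 b) \<star>\<^sub>0 Id2 v \<approx> Id2 a \<star>\<^sub>0 (Gen2 \<phi> \<star>\<^sub>0 Id2 b) \<star>\<^sub>0 Id2 v"
    using assms Step by (intro eqR_assoc0) auto
  also have "\<dots> \<approx> Id2 a \<star>\<^sub>0 Gen2 \<phi> \<star>\<^sub>0 Id2 (b \<bullet> v)"
    using assms Step by (intro eqR_comp0 eqR_refl right_whisker_right_whisker) auto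
  finally show ?thesis using Step by simp
qed

lemma step_cell_lwhisk:
  assumes "is_step \<Sigma> f" "u \<in> cells1 \<Sigma>" "tgt0 \<Sigma> u = src0 (ssrc \<Sigma> f)"
  shows "Id2 u \<star>\<^sub>0 step_cell f \<approx> step_cell (lwhisk u f)"
proof (cases f)
  case (Step a \<phi> b)
  then show ?thesis
    using assms left_whisker_left_whisker[of "Gen2 \<phi> \<star>\<^sub>0 Id2 b" a u] by auto
qed

lemma seq_cell_typed:
  "rewr_seq \<Sigma> u fs v \<Longrightarrow> typed2 \<Sigma> (seq_cell \<Sigma> u fs) \<and>
    src1 \<Sigma> (seq_cell \<Sigma> u fs) = u \<and> tgt1 \<Sigma> (seq_cell \<Sigma> u fs) = v"
  by (induction fs arbitrary: u) auto

lemma rewr_seq_append: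
  "rewr_seq \<Sigma> u fs v \<Longrightarrow> rewr_seq \<Sigma> v gs w \<Longrightarrow> rewr_seq \<Sigma> u (fs @ gs) w"
  by (induction fs arbitrary: u) auto

lemma seq_cell_append:
  "rewr_seq \<Sigma> u fs v \<Longrightarrow> rewr_seq \<Sigma> v gs w \<Longrightarrow>
    seq_cell \<Sigma> u (fs @ gs) \<approx> seq_cell \<Sigma> u fs \<star>\<^sub>1 seq_cell \<Sigma> v gs"
proof (induction fs arbitrary: u)
  case Nil
  then show ?case
    using seq_cell_typed[of v gs w] by (auto intro: cong2.sym[OF eqR_unit_left])
next
  case (Cons f fs)
  let ?x = "stgt \<Sigma> f"
  have s: "rewr_seq \<Sigma> ?x fs v" "is_step \<Sigma> f" using Cons.prems by auto
  note t = seq_cell_typed[OF s(1)] seq_cell_typed[OF Cons.prems(2)]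
    seq_cell_typed[OF rewr_seq_append[OF s(1) Cons.prems(2)]]
  have "step_cell f \<star>\<^sub>1 seq_cell \<Sigma> ?x (fs @ gs) \<approx>
      step_cell f \<star>\<^sub>1 seq_cell \<Sigma> ?x fs \<star>\<^sub>1 seq_cell \<Sigma> v gs"
    using s t Cons by (intro eqR_comp1 eqR_refl Cons.IH) auto
  also have "\<dots> \<approx> (step_cell f \<star>\<^sub>1 seq_cell \<Sigma> ?x fs) \<star>\<^sub>1 seq_cell \<Sigma> v gs"
    using s t by (intro cong2.sym[OF eqR_assoc1]) auto
  finally show ?case by simp
qed

lemma whisker_seq_cell:
  "rewr_seq \<Sigma> u fs v \<Longrightarrow> context_of \<Sigma> u w w' \<Longrightarrow>
    whisker w (seq_cell \<Sigma> u fs) w' \<approx> seq_cell \<Sigma> (w \<bullet> u \<bullet> w') (map (\<lambda>h. whisk w h w') fs)"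
proof (induction fs arbitrary: u)
  case Nil
  then show ?case by (auto intro: whisker_id2)
next
  case (Cons f fs)
  let ?x = "stgt \<Sigma> f"
  have s: "rewr_seq \<Sigma> ?x fs v" "is_step \<Sigma> f" "ssrc \<Sigma> f = u" using Cons.prems by auto
  have c: "context_of \<Sigma> ?x w w'" using s Cons.prems by (auto simp: context_of_def)
  note t = seq_cell_typed[OF s(1)]
  have "whisker w (step_cell f \<star>\<^sub>1 seq_cell \<Sigma> ?x fs) w' \<approx>
      whisker w (step_cell f) w' \<star>\<^sub>1 whisker w (seq_cell \<Sigma> ?x fs) w'"
    using s t Cons.prems by (intro whisker_comp1) auto
  also have "\<dots> \<approx> step_cell (whisk w f w') \<star>\<^sub>1
      seq_cell \<Sigma> (w \<bullet> ?x \<bullet> w') (map (\<lambda>h. whisk w h w') fs)"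
    using s t Cons.prems c by (intro eqR_comp1 whisker_step_cell Cons.IH) auto
  finally show ?case by simp
qed

text \<open>Naturality extends from steps to all 2-cells, so \<open>f\<close> and \<open>g\<close>
  agree after composition with the same \<open>\<tau>\<close>, which is then cancelled. The targets
  of \<open>\<tau>\<close> are left open: \<open>nat\<close> already forces them to agree at both
  ends of a step.\<close>

lemma parallel_eqR_if_natural:
  assumes \<tau>: "\<And>u. u \<in> cells1 \<Sigma> \<Longrightarrow> typed2 \<Sigma> (\<tau> u) \<and> src1 \<Sigma> (\<tau> u) = u"
    and nat: "\<And>f. is_step \<Sigma> f \<Longrightarrow> step_cell f \<star>\<^sub>1 \<tau> (stgt \<Sigma> f) \<approx> \<tau> (ssrc \<Sigma> f)"
    and "sphere2 \<Sigma> f g"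
  shows "f \<approx> g"
proof -
  \<comment> \<open>All contexts are needed at once: \<open>nat\<close> speaks of whiskered
    generators, and the factors of a \<open>\<star>\<^sub>0\<close>-composite appear whiskered by
    boundaries of each other.\<close>
  have W: "whisker w f w' \<star>\<^sub>1 \<tau> (w \<bullet> tgt1 \<Sigma> f \<bullet> w') \<approx> \<tau> (w \<bullet> src1 \<Sigma> f \<bullet> w')"
    if "typed2 \<Sigma> f" "context_of \<Sigma> (src1 \<Sigma> f) w w'" for f w w'
    using that
  proof (induction f arbitrary: w w')
    case (Gen2 \<phi>)
    then show ?case
      using nat[of "Step w \<phi> w'"] by (auto simp: whisker_def context_of_def)
  next
    case (Id2 u)
    let ?t = "\<tau> (w \<bullet> u \<bullet> w')"
    have t: "typed2 \<Sigma> ?t" "src1 \<Sigma> ?t = w \<bullet> u \<bullet> w'"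
      using \<tau>[of "w \<bullet> u \<bullet> w'"] Id2 by (auto simp: context_of_def)
    have "whisker w (Id2 u) w' \<star>\<^sub>1 ?t \<approx> Id2 (w \<bullet> u \<bullet> w') \<star>\<^sub>1 ?t"
      using Id2 t by (intro eqR_comp1 whisker_id2 eqR_refl) auto
    also have "\<dots> \<approx> ?t" using t by (intro eqR_unit_left) auto
    finally show ?case by simp
  next
    case (Comp0 f g)
    let ?f = "whisker w f (src1 \<Sigma> g \<bullet> w')" and ?g = "whisker (w \<bullet> tgt1 \<Sigma> f) g w'"
    let ?t = "\<tau> (w \<bullet> tgt1 \<Sigma> f \<bullet> tgt1 \<Sigma> g \<bullet> w')"
    have t: "typed2 \<Sigma> ?t" "src1 \<Sigma> ?t = w \<bullet> tgt1 \<Sigma> f \<bullet> tgt1 \<Sigma> g \<bullet> w'"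
      using \<tau>[of "w \<bullet> tgt1 \<Sigma> f \<bullet> tgt1 \<Sigma> g \<bullet> w'"] Comp0.prems by (auto simp: context_of_def)
    have c: "context_of \<Sigma> (src1 \<Sigma> f) w (src1 \<Sigma> g \<bullet> w')"
      "context_of \<Sigma> (src1 \<Sigma> g) (w \<bullet> tgt1 \<Sigma> f) w'"
      using Comp0.prems by (auto simp: context_of_def)
    have "whisker w (f \<star>\<^sub>0 g) w' \<star>\<^sub>1 ?t \<approx> (?f \<star>\<^sub>1 ?g) \<star>\<^sub>1 ?t"
      using Comp0.prems t by (intro eqR_comp1 whisker_comp0 eqR_refl) auto
    also have "\<dots> \<approx> ?f \<star>\<^sub>1 ?g \<star>\<^sub>1 ?t"
      using Comp0.prems t c by (intro eqR_assoc1) auto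
    also have "\<dots> \<approx> ?f \<star>\<^sub>1 \<tau> (w \<bullet> tgt1 \<Sigma> f \<bullet> src1 \<Sigma> g \<bullet> w')"
      using Comp0.prems t c Comp0.IH(2)[of "w \<bullet> tgt1 \<Sigma> f" w'] by (intro eqR_comp1 eqR_refl) auto
    also have "\<dots> \<approx> \<tau> (w \<bullet> src1 \<Sigma> f \<bullet> src1 \<Sigma> g \<bullet> w')"
      using Comp0.prems c Comp0.IH(1)[of w "src1 \<Sigma> g \<bullet> w'"] by simp
    finally show ?case by simp
  next
    case (Comp1 f g)
    let ?f = "whisker w f w'" and ?g = "whisker w g w'"
    let ?t = "\<tau> (w \<bullet> tgt1 \<Sigma> g \<bullet> w')"
    have c: "context_of \<Sigma> (src1 \<Sigma> f) w w'" "context_of \<Sigma> (src1 \<Sigma> g) w w'"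
      using Comp1.prems comp1_boundary0[OF Comp1.prems(1)] by (auto simp: context_of_def)
    have t: "typed2 \<Sigma> ?t" "src1 \<Sigma> ?t = w \<bullet> tgt1 \<Sigma> g \<bullet> w'"
      using \<tau>[of "w \<bullet> tgt1 \<Sigma> g \<bullet> w'"] Comp1.prems c by (auto simp: context_of_def)
    have "whisker w (f \<star>\<^sub>1 g) w' \<star>\<^sub>1 ?t \<approx> (?f \<star>\<^sub>1 ?g) \<star>\<^sub>1 ?t"
      using Comp1.prems t by (intro eqR_comp1 whisker_comp1 eqR_refl) auto
    also have "\<dots> \<approx> ?f \<star>\<^sub>1 ?g \<star>\<^sub>1 ?t"
      using Comp1.prems t c by (intro eqR_assoc1) auto
    also have "\<dots> \<approx> ?f \<star>\<^sub>1 \<tau> (w \<bullet> tgt1 \<Sigma> f \<bullet> w')"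
      using Comp1.prems t c Comp1.IH(2)[of w w'] by (intro eqR_comp1 eqR_refl) auto
    also have "\<dots> \<approx> \<tau> (w \<bullet> src1 \<Sigma> f \<bullet> w')"
      using Comp1.prems c Comp1.IH(1)[of w w'] by simp
    finally show ?case by simp
  next
    case (Inv2 f)
    let ?f = "whisker w f w'" and ?i = "whisker w (Inv2 f) w'"
    let ?s = "\<tau> (w \<bullet> src1 \<Sigma> f \<bullet> w')" and ?t = "\<tau> (w \<bullet> tgt1 \<Sigma> f \<bullet> w')"
    have c: "context_of \<Sigma> (src1 \<Sigma> f) w w'" "context_of \<Sigma> (tgt1 \<Sigma> f) w w'"
      using Inv2.prems by (auto simp: context_of_def)
    have t: "typed2 \<Sigma> ?t" "src1 \<Sigma> ?t = w \<bullet> tgt1 \<Sigma> f \<bullet> w'"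
      using \<tau>[of "w \<bullet> tgt1 \<Sigma> f \<bullet> w'"] Inv2.prems by (auto simp: context_of_def)
    have IH: "?f \<star>\<^sub>1 ?t \<approx> ?s" using Inv2 c by simp
    \<comment> \<open>Whiskering respects \<open>\<star>\<^sub>1\<close> and identities, so
      \<open>?i\<close> is a left inverse of \<open>?f\<close>; expanding \<open>?s\<close> by the
      induction hypothesis lets the two cancel.\<close>
    have "?i \<star>\<^sub>1 ?s \<approx> ?i \<star>\<^sub>1 ?f \<star>\<^sub>1 ?t"
      using Inv2.prems eqR_boundary[OF IH] by (intro eqR_comp1 eqR_refl cong2.sym[OF IH]) auto
    also have "\<dots> \<approx> (?i \<star>\<^sub>1 ?f) \<star>\<^sub>1 ?t"
      using Inv2.prems t c by (intro cong2.sym[OF eqR_assoc1]) auto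
    also have "\<dots> \<approx> whisker w (Inv2 f \<star>\<^sub>1 f) w' \<star>\<^sub>1 ?t"
      using Inv2.prems t c by (intro eqR_comp1 eqR_refl cong2.sym[OF whisker_comp1]) auto
    also have "\<dots> \<approx> whisker w (Id2 (tgt1 \<Sigma> f)) w' \<star>\<^sub>1 ?t"
      using Inv2.prems t c by (intro eqR_comp1 eqR_refl whisker_cong eqR_inv_left) auto
    also have "\<dots> \<approx> Id2 (w \<bullet> tgt1 \<Sigma> f \<bullet> w') \<star>\<^sub>1 ?t"
      using Inv2.prems t c by (intro eqR_comp1 eqR_refl whisker_id2) auto
    also have "\<dots> \<approx> ?t" using t by (intro eqR_unit_left) auto
    finally show ?case by simp
  qed
  have N: "f \<star>\<^sub>1 \<tau> (tgt1 \<Sigma> f) \<approx> \<tau> (src1 \<Sigma> f)" if f: "typed2 \<Sigma> f" for f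
  proof -
    let ?w = "id1 (src0 (src1 \<Sigma> f))" and ?w' = "id1 (tgt0 \<Sigma> (src1 \<Sigma> f))"
    have c: "context_of \<Sigma> (src1 \<Sigma> f) ?w ?w'"
      using f id1_in[OF polygraph] src0_in[OF polygraph] tgt0_in[OF polygraph]
      by (auto simp: context_of_def)
    have e: "?w \<bullet> src1 \<Sigma> f = src1 \<Sigma> f" "?w \<bullet> tgt1 \<Sigma> f = tgt1 \<Sigma> f"
      using f id1_pcomp[OF polygraph, of "tgt1 \<Sigma> f"] by auto
    have t: "typed2 \<Sigma> (\<tau> (tgt1 \<Sigma> f))" "src1 \<Sigma> (\<tau> (tgt1 \<Sigma> f)) = tgt1 \<Sigma> f"
      using \<tau> f by auto
    have "f \<star>\<^sub>1 \<tau> (tgt1 \<Sigma> f) \<approx> whisker ?w f ?w' \<star>\<^sub>1 \<tau> (tgt1 \<Sigma> f)"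
      using f t by (intro eqR_comp1 eqR_refl cong2.sym[OF whisker_id1]) auto
    also have "\<dots> \<approx> \<tau> (src1 \<Sigma> f)"
      using W[OF f c] e by simp
    finally show ?thesis .
  qed
  have t: "typed2 \<Sigma> f" "typed2 \<Sigma> g" "src1 \<Sigma> f = src1 \<Sigma> g" "tgt1 \<Sigma> f = tgt1 \<Sigma> g"
    using \<open>sphere2 \<Sigma> f g\<close> by (auto simp: sphere2_def cells21_def)
  have "f \<star>\<^sub>1 \<tau> (tgt1 \<Sigma> f) \<approx> g \<star>\<^sub>1 \<tau> (tgt1 \<Sigma> f)"
    using N[OF t(1)] cong2.sym[OF N[OF t(2)]] unfolding t(3,4) by (rule cong2.trans)
  then show ?thesis by (rule cancel_right)
qed


section \<open>Loops\<close>

text \<open>Membership in the term set and in the relation occurs only positively in the clauses of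
  \<open>cong2\<close>. Hence equalities of the free 2-category and of the free (2,1)-category
  persist modulo \<open>R\<close>.\<close>

lemma cong2_mono:
  assumes "cong2 \<Sigma> T Q f g" "T \<subseteq> T'" "Q \<subseteq> Q'"
  shows "cong2 \<Sigma> T' Q' f g"
  using assms by (induction rule: cong2.induct) (blast intro: cong2.intros)+

lemma eq2_imp_eqR: "eq2 \<Sigma> f g \<Longrightarrow> f \<approx> g"
  unfolding eq2_def by (erule cong2_mono) (auto simp: cells2_def cells21_def)

lemma eq21_imp_eqR: "eq21 \<Sigma> f g \<Longrightarrow> f \<approx> g"
  unfolding eq21_def by (erule cong2_mono) auto

lemma eq2_in_cells2:
  assumes "eq2 \<Sigma> f g"
  shows "f \<in> cells2 \<Sigma>" "g \<in> cells2 \<Sigma>"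
  using cong2_boundary[OF polygraph assms[unfolded eq2_def]] by auto

section \<open>Number of generators of a 2-cell\<close>

primrec gen_count :: "('v, 'e, 'r) term2 \<Rightarrow> nat" where
  "gen_count (Gen2 \<phi>) = 1"
| "gen_count (Id2 u) = 0"
| "gen_count (f \<star>\<^sub>0 g) = gen_count f + gen_count g"
| "gen_count (f \<star>\<^sub>1 g) = gen_count f + gen_count g"
| "gen_count (Inv2 f) = gen_count f"

text \<open>No axiom of 2-categories creates or destroys a generator. The inverse laws would, but
  they have no instance among inverse-free terms.\<close>

lemma eq2_gen_count:
  assumes "eq2 \<Sigma> f g"
  shows "gen_count f = gen_count g"
  using assms unfolding eq2_def
  by (induction rule: cong2.induct) (auto simp: cells2_def)

text \<open>Composites of identities collapse by \<open>id_comp0\<close> and the unit laws.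
  Conversely read: a loop that is not an identity contains a generator, which makes the count a
  usable measure.\<close>

lemma eq2_Id2_if_gen_count_0:
  "f \<in> cells2 \<Sigma> \<Longrightarrow> gen_count f = 0 \<Longrightarrow> eq2 \<Sigma> f (Id2 (src1 \<Sigma> f)) \<and> src1 \<Sigma> f = tgt1 \<Sigma> f"
proof (induction f)
  case (Id2 u)
  then show ?case by (auto simp: eq2_def intro: cong2.refl)
next
  case (Comp0 f g)
  then have s: "f \<in> cells2 \<Sigma>" "g \<in> cells2 \<Sigma>" by (auto simp: cells2_def)
  then have IH: "eq2 \<Sigma> f (Id2 (src1 \<Sigma> f))" "src1 \<Sigma> f = tgt1 \<Sigma> f"
    "eq2 \<Sigma> g (Id2 (src1 \<Sigma> g))" "src1 \<Sigma> g = tgt1 \<Sigma> g"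
    using Comp0 by auto
  have "eq2 \<Sigma> (f \<star>\<^sub>0 g) (Id2 (src1 \<Sigma> f) \<star>\<^sub>0 Id2 (src1 \<Sigma> g))"
    using IH Comp0.prems unfolding eq2_def by (intro cong2.comp0) auto
  moreover have "eq2 \<Sigma> (Id2 (src1 \<Sigma> f) \<star>\<^sub>0 Id2 (src1 \<Sigma> g)) (Id2 (src1 \<Sigma> f \<bullet> src1 \<Sigma> g))"
    using Comp0.prems unfolding eq2_def by (intro cong2.id_comp0) (auto simp: cells2_def)
  ultimately show ?case
    using IH by (auto simp: eq2_def intro: cong2.trans)
next
  case (Comp1 f g)
  then have s: "f \<in> cells2 \<Sigma>" "g \<in> cells2 \<Sigma>" "tgt1 \<Sigma> f = src1 \<Sigma> g" by (auto simp: cells2_def)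
  then have IH: "eq2 \<Sigma> f (Id2 (src1 \<Sigma> f))" "src1 \<Sigma> f = tgt1 \<Sigma> f"
    "eq2 \<Sigma> g (Id2 (src1 \<Sigma> g))" "src1 \<Sigma> g = tgt1 \<Sigma> g"
    using Comp1 by auto
  have "eq2 \<Sigma> (f \<star>\<^sub>1 g) (Id2 (src1 \<Sigma> f) \<star>\<^sub>1 Id2 (src1 \<Sigma> f))"
    using IH s Comp1.prems unfolding eq2_def by (intro cong2.comp1) auto
  moreover have "eq2 \<Sigma> (Id2 (src1 \<Sigma> f) \<star>\<^sub>1 Id2 (src1 \<Sigma> f)) (Id2 (src1 \<Sigma> f))"
    using Comp1.prems cong2.unit1_left[of "Id2 (src1 \<Sigma> f)" "cells2 \<Sigma>" \<Sigma> "{}"]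
    unfolding eq2_def by (auto simp: cells2_def)
  ultimately show ?case
    using IH s by (auto simp: eq2_def intro: cong2.trans)
qed (auto simp: cells2_def)

lemma eq2_comp1_units:
  assumes "g \<star>\<^sub>1 h \<star>\<^sub>1 k \<in> cells2 \<Sigma>" "gen_count g = 0" "gen_count k = 0"
  shows "eq2 \<Sigma> (g \<star>\<^sub>1 h \<star>\<^sub>1 k) h"
proof -
  have t: "g \<in> cells2 \<Sigma>" "h \<in> cells2 \<Sigma>" "k \<in> cells2 \<Sigma>" "h \<star>\<^sub>1 k \<in> cells2 \<Sigma>"
    "tgt1 \<Sigma> g = src1 \<Sigma> h" "tgt1 \<Sigma> h = src1 \<Sigma> k"
    using assms(1) by (auto simp: cells2_def)
  have gk: "eq2 \<Sigma> g (Id2 (src1 \<Sigma> h))" "eq2 \<Sigma> k (Id2 (tgt1 \<Sigma> h))"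
    using eq2_Id2_if_gen_count_0 t assms by metis+
  have "eq2 \<Sigma> (h \<star>\<^sub>1 k) (h \<star>\<^sub>1 Id2 (tgt1 \<Sigma> h))"
    using gk t unfolding eq2_def by (intro cong2.comp1 cong2.refl)
  moreover have "eq2 \<Sigma> (h \<star>\<^sub>1 Id2 (tgt1 \<Sigma> h)) h"
    using t unfolding eq2_def by (intro cong2.unit1_right)
  ultimately have "eq2 \<Sigma> (h \<star>\<^sub>1 k) h"
    unfolding eq2_def by (rule cong2.trans)
  then have "eq2 \<Sigma> (g \<star>\<^sub>1 h \<star>\<^sub>1 k) (Id2 (src1 \<Sigma> h) \<star>\<^sub>1 h)"
    using gk assms(1) unfolding eq2_def by (intro cong2.comp1)
  moreover have "eq2 \<Sigma> (Id2 (src1 \<Sigma> h) \<star>\<^sub>1 h) h"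
    using t unfolding eq2_def by (intro cong2.unit1_left)
  ultimately show ?thesis
    unfolding eq2_def by (rule cong2.trans)
qed

text \<open>Both \<open>(g \<star>\<^sub>1 h) \<star>\<^sub>1 g\<close> and
  \<open>Id2 (src1 \<Sigma> g) \<star>\<^sub>1 g\<close> reduce to \<open>g\<close>, which is then
  cancelled.\<close>

lemma conjugate_trivial:
  assumes "typed2 \<Sigma> (g \<star>\<^sub>1 h)" "h \<star>\<^sub>1 g \<approx> Id2 (src1 \<Sigma> h)"
  shows "g \<star>\<^sub>1 h \<approx> Id2 (src1 \<Sigma> g)"
proof -
  have t: "typed2 \<Sigma> g" "typed2 \<Sigma> h" "tgt1 \<Sigma> g = src1 \<Sigma> h" "tgt1 \<Sigma> h = src1 \<Sigma> g"
    using assms(1) eqR_boundary[OF assms(2)] by auto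
  have "(g \<star>\<^sub>1 h) \<star>\<^sub>1 g \<approx> g \<star>\<^sub>1 h \<star>\<^sub>1 g"
    using t by (intro eqR_assoc1) auto
  also have "\<dots> \<approx> g \<star>\<^sub>1 Id2 (src1 \<Sigma> h)"
    using t by (intro eqR_comp1 eqR_refl assms(2)) auto
  also have "\<dots> \<approx> g" using t by (intro eqR_unit_right) auto
  also have "\<dots> \<approx> Id2 (src1 \<Sigma> g) \<star>\<^sub>1 g" using t by (intro cong2.sym[OF eqR_unit_left]) auto
  finally show ?thesis by (rule cancel_right)
qed

text \<open>Moving the initial piece of a loop to its end is conjugation by that piece, and a
  conjugate of an identity is an identity. So one 3-cell per equivalence class of elementary loops
  is enough.\<close>

lemma loop_rotation_trivial:
  assumes "loop_rotation \<Sigma> f g" "g \<approx> Id2 (src1 \<Sigma> g)"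
  shows "f \<approx> Id2 (src1 \<Sigma> f)"
proof -
  obtain u v fs gs where s: "rewr_seq \<Sigma> u fs v" "rewr_seq \<Sigma> v gs u"
    and f: "f \<approx> seq_cell \<Sigma> u (fs @ gs)" and g: "g \<approx> seq_cell \<Sigma> v (gs @ fs)"
    using assms(1) unfolding loop_rotation_def by (blast intro: eq2_imp_eqR)
  note t = seq_cell_typed[OF s(1)] seq_cell_typed[OF s(2)]
  have u: "src1 \<Sigma> f = u" "src1 \<Sigma> g = v"
    using eqR_boundary(3)[OF f] eqR_boundary(3)[OF g] seq_cell_typed rewr_seq_append s by metis+
  have "seq_cell \<Sigma> v gs \<star>\<^sub>1 seq_cell \<Sigma> u fs \<approx> g"
    by (rule cong2.sym[OF cong2.trans[OF g seq_cell_append[OF s(2,1)]]])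
  also have "g \<approx> Id2 v" using assms(2) u by simp
  finally have *: "seq_cell \<Sigma> v gs \<star>\<^sub>1 seq_cell \<Sigma> u fs \<approx> Id2 v" .
  have "f \<approx> seq_cell \<Sigma> u fs \<star>\<^sub>1 seq_cell \<Sigma> v gs"
    by (rule cong2.trans[OF f seq_cell_append[OF s]])
  also have "\<dots> \<approx> Id2 u"
    using conjugate_trivial[of "seq_cell \<Sigma> u fs" "seq_cell \<Sigma> v gs"] * t by simp
  finally show ?thesis using u by simp
qed

lemma loop_equiv_trivial:
  assumes "loop_equiv \<Sigma> f g" "g \<approx> Id2 (src1 \<Sigma> g)"
  shows "f \<approx> Id2 (src1 \<Sigma> f)"
  using assms unfolding loop_equiv_def
  by (induction rule: converse_tranclp_induct) (auto intro: loop_rotation_trivial)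

text \<open>Splitting a loop by \<open>\<star>\<^sub>1\<close> decreases the number of generators, and stripping a context
  preserves it but shortens the source.\<close>

lemma loop_trivial:
  assumes elementary: "\<And>f. elementary_loop \<Sigma> f \<Longrightarrow> f \<approx> Id2 (src1 \<Sigma> f)"
  shows "loop2 \<Sigma> f \<Longrightarrow> f \<approx> Id2 (src1 \<Sigma> f)"
proof (induction f rule: wf_induct_rule[OF wf_measures[of "[gen_count, \<lambda>f. length (edges (src1 \<Sigma> f))]"]])
  case (1 f)
  have t: "typed2 \<Sigma> f" "f \<in> cells2 \<Sigma>" "src1 \<Sigma> f = tgt1 \<Sigma> f"
    using 1(2) by (auto simp: loop2_def cells2_def)
  consider "elementary_loop \<Sigma> f" | "\<not> minimal_comp1 \<Sigma> f" | "\<not> minimal_context \<Sigma> f"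
    using 1(2) by (auto simp: elementary_loop_def)
  then show ?case
  proof cases
    case 1
    then show ?thesis by (rule elementary)
  next
    case 2
    then obtain g h k where h: "loop2 \<Sigma> h" and f: "eq2 \<Sigma> f (g \<star>\<^sub>1 h \<star>\<^sub>1 k)"
      and ne: "\<not> eq2 \<Sigma> h (Id2 (src1 \<Sigma> h))" "\<not> eq2 \<Sigma> h f"
      unfolding minimal_comp1_def by blast
    note c = eq2_in_cells2(2)[OF f]
    have d: "g \<in> cells2 \<Sigma>" "h \<in> cells2 \<Sigma>" "k \<in> cells2 \<Sigma>" "tgt1 \<Sigma> g = src1 \<Sigma> h"
      "tgt1 \<Sigma> h = src1 \<Sigma> k" "src1 \<Sigma> h = tgt1 \<Sigma> h" "typed2 \<Sigma> g" "typed2 \<Sigma> h" "typed2 \<Sigma> k"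
      using c h by (auto simp: cells2_def loop2_def)
    have n: "gen_count f = gen_count g + gen_count h + gen_count k"
      using eq2_gen_count[OF f] by simp
    \<comment> \<open>The two disjuncts excluded by \<open>ne\<close> make both pieces smaller than
      \<open>f\<close>: as \<open>h\<close> is not an identity it has a generator, so
      \<open>g \<star>\<^sub>1 k\<close> has fewer; as \<open>h\<close> is not \<open>f\<close>, one
      of \<open>g\<close> and \<open>k\<close> has a generator, so \<open>h\<close> has
      fewer.\<close>
    have h0: "gen_count h > 0"
      using eq2_Id2_if_gen_count_0 d ne by blast
    have "gen_count g + gen_count k > 0"
    proof (rule ccontr)
      assume "\<not> ?thesis"
      then have "eq2 \<Sigma> (g \<star>\<^sub>1 h \<star>\<^sub>1 k) h" using c by (intro eq2_comp1_units) auto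
      then have "eq2 \<Sigma> h f" using f unfolding eq2_def by (blast intro: cong2.sym cong2.trans)
      then show False using ne by blast
    qed
    then have h1: "h \<approx> Id2 (src1 \<Sigma> h)" using "1.IH" n h by simp
    note b = eqR_boundary[OF eq2_imp_eqR[OF f]]
    \<comment> \<open>Cutting out \<open>h\<close>, whose source and target coincide, leaves
      \<open>g\<close> and \<open>k\<close> composable.\<close>
    have "loop2 \<Sigma> (g \<star>\<^sub>1 k)" using d b t by (auto simp: loop2_def cells2_def)
    then have gk: "g \<star>\<^sub>1 k \<approx> Id2 (src1 \<Sigma> g)" using "1.IH"[of "g \<star>\<^sub>1 k"] n h0 by simp
    have "f \<approx> g \<star>\<^sub>1 h \<star>\<^sub>1 k" by (rule eq2_imp_eqR[OF f])
    also have "\<dots> \<approx> g \<star>\<^sub>1 Id2 (src1 \<Sigma> h) \<star>\<^sub>1 k"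
      using d by (intro eqR_comp1 eqR_refl h1) auto
    also have "\<dots> \<approx> g \<star>\<^sub>1 k"
      using d by (intro eqR_comp1 eqR_refl eqR_unit_left) auto
    also have "\<dots> \<approx> Id2 (src1 \<Sigma> f)" using gk b by simp
    finally show ?thesis .
  next
    case 3
    then obtain u g v where g: "loop2 \<Sigma> g" and uv: "\<not> is_id1 u" "\<not> is_id1 v"
      and f: "eq2 \<Sigma> f (whisker u g v)"
      unfolding minimal_context_def whisker_def by blast
    note b = eqR_boundary[OF eq2_imp_eqR[OF f]]
    have d: "src1 \<Sigma> g \<in> cells1 \<Sigma>" "context_of \<Sigma> (src1 \<Sigma> g) u v"
      using b(2) by (auto simp: whisker_def context_of_def)
    have "gen_count f = gen_count g"
      using eq2_gen_count[OF f] by (simp add: whisker_def)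
    moreover have "length (edges (src1 \<Sigma> g)) < length (edges (src1 \<Sigma> f))"
      using b(3) uv by (auto simp: pcomp_def is_id1_def)
    ultimately have g1: "g \<approx> Id2 (src1 \<Sigma> g)" using "1.IH" g by simp
    have "f \<approx> whisker u g v" by (rule eq2_imp_eqR[OF f])
    also have "\<dots> \<approx> whisker u (Id2 (src1 \<Sigma> g)) v" by (rule whisker_cong[OF g1 d(2)])
    also have "\<dots> \<approx> Id2 (src1 \<Sigma> f)" using whisker_id2[OF d] b by simp
    finally show ?thesis .
  qed
qed


section \<open>Strictly decreasing local branchings filled by relations\<close>

definition filled_sd :: "('w \<Rightarrow> 'w \<Rightarrow> bool) \<Rightarrow> (('v, 'e, 'r) step \<Rightarrow> 'w) \<Rightarrow>
    ('v, 'e, 'r) step \<Rightarrow> ('v, 'e, 'r) step \<Rightarrow> bool" where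
  "filled_sd lt \<psi> f g \<longleftrightarrow> (\<exists>f' g'. sd_diagram \<Sigma> lt \<psi> f f' g g' \<and>
     seq_cell \<Sigma> (ssrc \<Sigma> f) (f # f') \<approx> seq_cell \<Sigma> (ssrc \<Sigma> g) (g # g'))"

lemma filled_sd_sym: "filled_sd lt \<psi> f g \<Longrightarrow> filled_sd lt \<psi> g f"
  unfolding filled_sd_def sd_diagram_def confluence_diagram_def local_branching_def
  by (metis cong2.sym)

lemma filled_sd_refl:
  assumes "is_step \<Sigma> f"
  shows "filled_sd lt \<psi> f f"
  unfolding filled_sd_def using assms
  by (intro exI[of _ "[]"] conjI eqR_refl)
    (auto simp: sd_diagram_def confluence_diagram_def local_branching_def)

text \<open>The relation between the two sides survives any context, since whiskering a sequence is
  whiskering its steps. Labels may change in a context, and \<open>compat\<close> is what keeps the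
  diagram strictly decreasing.\<close>

lemma filled_sd_whisk:
  assumes compat: "compatible_with_contexts \<Sigma> lt \<psi>"
    and "filled_sd lt \<psi> f g" and c: "context_of \<Sigma> (ssrc \<Sigma> f) w w'"
  shows "filled_sd lt \<psi> (whisk w f w') (whisk w g w')"
proof -
  let ?W = "map (\<lambda>h. whisk w h w')"
  obtain f' g' where d: "sd_diagram \<Sigma> lt \<psi> f f' g g'"
    and eq: "seq_cell \<Sigma> (ssrc \<Sigma> f) (f # f') \<approx> seq_cell \<Sigma> (ssrc \<Sigma> g) (g # g')"
    using assms(2) unfolding filled_sd_def by blast
  obtain x where s: "rewr_seq \<Sigma> (ssrc \<Sigma> f) (f # f') x" "rewr_seq \<Sigma> (ssrc \<Sigma> g) (g # g') x"
    and e: "ssrc \<Sigma> g = ssrc \<Sigma> f"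
    using d unfolding sd_diagram_def confluence_diagram_def local_branching_def by metis
  have "seq_cell \<Sigma> (w \<bullet> ssrc \<Sigma> f \<bullet> w') (?W (f # f')) \<approx>
      whisker w (seq_cell \<Sigma> (ssrc \<Sigma> f) (f # f')) w'"
    by (rule cong2.sym[OF whisker_seq_cell[OF s(1) c]])
  also have "\<dots> \<approx> whisker w (seq_cell \<Sigma> (ssrc \<Sigma> g) (g # g')) w'"
    using c by (intro whisker_cong eq) auto
  also have "\<dots> \<approx> seq_cell \<Sigma> (w \<bullet> ssrc \<Sigma> g \<bullet> w') (?W (g # g'))"
    using c e by (intro whisker_seq_cell[OF s(2)]) simp
  finally show ?thesis
    using compat d c unfolding filled_sd_def compatible_with_contexts_def
    by (intro exI[of _ "?W f'"] exI[of _ "?W g'"]) simp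
qed

text \<open>The relation \<open>eq\<close> compares the closing sides of the exchange square with
  those of the diagram; pasting the exchange square onto it gives a filling of the diagram.\<close>

lemma filled_sd_peiffer:
  assumes h: "is_step \<Sigma> h" and k: "is_step \<Sigma> k" and hk: "tgt0 \<Sigma> (ssrc \<Sigma> h) = src0 (ssrc \<Sigma> k)"
    and d: "sd_diagram \<Sigma> lt \<psi> (rwhisk h (ssrc \<Sigma> k)) f' (lwhisk (ssrc \<Sigma> h) k) g'"
    and eq: "step_cell (lwhisk (stgt \<Sigma> h) k) \<star>\<^sub>1 Inv2 (step_cell (rwhisk h (stgt \<Sigma> k))) \<approx>
      seq_cell \<Sigma> (stgt \<Sigma> h \<bullet> ssrc \<Sigma> k) f' \<star>\<^sub>1 Inv2 (seq_cell \<Sigma> (ssrc \<Sigma> h \<bullet> stgt \<Sigma> k) g')"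
  shows "filled_sd lt \<psi> (rwhisk h (ssrc \<Sigma> k)) (lwhisk (ssrc \<Sigma> h) k)"
proof -
  let ?u = "ssrc \<Sigma> h" and ?u' = "stgt \<Sigma> h" and ?v = "ssrc \<Sigma> k" and ?v' = "stgt \<Sigma> k"
  let ?f = "step_cell (rwhisk h ?v)" and ?g = "step_cell (lwhisk ?u k)"
  let ?p = "step_cell (lwhisk ?u' k)" and ?q = "step_cell (rwhisk h ?v')"
  let ?F = "seq_cell \<Sigma> (?u' \<bullet> ?v) f'" and ?G = "seq_cell \<Sigma> (?u \<bullet> ?v') g'"
  have b: "ssrc \<Sigma> (rwhisk h w) = ?u \<bullet> w" "stgt \<Sigma> (rwhisk h w) = ?u' \<bullet> w"
    "ssrc \<Sigma> (lwhisk w k) = w \<bullet> ?v" "stgt \<Sigma> (lwhisk w k) = w \<bullet> ?v'" for w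
    by (cases h; cases k; simp)+
  obtain x where s: "rewr_seq \<Sigma> (?u' \<bullet> ?v) f' x" "rewr_seq \<Sigma> (?u \<bullet> ?v') g' x"
    "is_step \<Sigma> (rwhisk h ?v)" "is_step \<Sigma> (lwhisk ?u k)"
    using d b unfolding sd_diagram_def confluence_diagram_def by auto
  note t = seq_cell_typed[OF s(1)] seq_cell_typed[OF s(2)]
  have st: "is_step \<Sigma> (lwhisk ?u' k)" "is_step \<Sigma> (rwhisk h ?v')"
    using eqR_boundary(1)[OF eq] h k hk by (cases h; cases k; auto)+
  have "?f \<star>\<^sub>1 ?p \<approx> (step_cell h \<star>\<^sub>0 Id2 ?v) \<star>\<^sub>1 (Id2 ?u' \<star>\<^sub>0 step_cell k)"
    using h k hk b by (intro eqR_comp1 cong2.sym[OF step_cell_rwhisk] cong2.sym[OF step_cell_lwhisk]) auto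
  also have "\<dots> \<approx> step_cell h \<star>\<^sub>0 step_cell k"
    using cong2.sym[OF comp0_eq_right_left[of "step_cell h" "step_cell k"]] h k hk by simp
  also have "\<dots> \<approx> (Id2 ?u \<star>\<^sub>0 step_cell k) \<star>\<^sub>1 (step_cell h \<star>\<^sub>0 Id2 ?v')"
    using comp0_eq_left_right[of "step_cell h" "step_cell k"] h k hk by simp
  also have "\<dots> \<approx> ?g \<star>\<^sub>1 ?q"
    using h k hk b by (intro eqR_comp1 step_cell_rwhisk step_cell_lwhisk) auto
  finally have ex: "?f \<star>\<^sub>1 ?p \<approx> ?g \<star>\<^sub>1 ?q" .
  \<comment> \<open>\<open>eq\<close> mentions \<open>?F\<close> only followed by
    \<open>Inv2 ?G\<close>, so the two sides are compared after composition with
    \<open>Inv2 ?G\<close>.\<close>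
  have "(?f \<star>\<^sub>1 ?F) \<star>\<^sub>1 Inv2 ?G \<approx> ?f \<star>\<^sub>1 ?F \<star>\<^sub>1 Inv2 ?G"
    using s t b by (intro eqR_assoc1) auto
  also have "\<dots> \<approx> ?f \<star>\<^sub>1 ?p \<star>\<^sub>1 Inv2 ?q"
    using s t b by (intro eqR_comp1 eqR_refl cong2.sym[OF eq]) auto
  also have "\<dots> \<approx> (?f \<star>\<^sub>1 ?p) \<star>\<^sub>1 Inv2 ?q"
    using s st b by (intro cong2.sym[OF eqR_assoc1]) auto
  also have "\<dots> \<approx> (?g \<star>\<^sub>1 ?q) \<star>\<^sub>1 Inv2 ?q"
    using st b by (intro eqR_comp1 eqR_refl ex) auto
  also have "\<dots> \<approx> ?g \<star>\<^sub>1 ?q \<star>\<^sub>1 Inv2 ?q"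
    using s st b by (intro eqR_assoc1) auto
  also have "\<dots> \<approx> ?g \<star>\<^sub>1 Id2 (ssrc \<Sigma> (rwhisk h ?v'))"
    using s st b eqR_inv_right[of ?q] by (intro eqR_comp1 eqR_refl) auto
  also have "\<dots> \<approx> ?g \<star>\<^sub>1 ?G \<star>\<^sub>1 Inv2 ?G"
    using s t b cong2.sym[OF eqR_inv_right[of ?G]] by (intro eqR_comp1 eqR_refl) auto
  also have "\<dots> \<approx> (?g \<star>\<^sub>1 ?G) \<star>\<^sub>1 Inv2 ?G"
    using s t b by (intro cong2.sym[OF eqR_assoc1]) auto
  finally have "?f \<star>\<^sub>1 ?F \<approx> ?g \<star>\<^sub>1 ?G" by (rule cancel_right)
  then show ?thesis
    unfolding filled_sd_def using d b by (intro exI[of _ f'] exI[of _ g']) auto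
qed

text \<open>A branching that is not minimal sits in a nontrivial context over another one, whose
  source has fewer edges. The descent stops at a critical branching, and the contexts met on the way
  compose.\<close>

lemma overlapping_above_critical:
  "overlapping \<Sigma> f g \<Longrightarrow>
    \<exists>f0 g0 w w'. critical \<Sigma> f0 g0 \<and> context_of \<Sigma> (ssrc \<Sigma> f0) w w' \<and>
      f = whisk w f0 w' \<and> g = whisk w g0 w'"
proof (induction "length (edges (ssrc \<Sigma> f))" arbitrary: f g rule: less_induct)
  case less
  have st: "is_step \<Sigma> f" "is_step \<Sigma> g" "ssrc \<Sigma> g = ssrc \<Sigma> f"
    using less.prems by (auto simp: overlapping_def local_branching_def)
  \<comment> \<open>A path without edges still carries a vertex, and \<open>pcomp\<close> takes its
    source from the left factor; \<open>context_of\<close> makes that vertex the right one, so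
    \<open>h\<close> is literally unchanged.\<close>
  have trivial: "whisk w h w' = h"
    if "is_step \<Sigma> h" "context_of \<Sigma> (ssrc \<Sigma> h) w w'" "edges w = []" "edges w' = []" for h w w'
    using that by (cases h; cases w; cases w')
      (auto simp: whisk_def context_of_def pcomp_def tgt0_def pre_digraph.awalk_verts.simps
        path.expand)
  show ?case
  proof (cases "critical \<Sigma> f g")
    case True
    let ?w = "id1 (src0 (ssrc \<Sigma> f))" and ?w' = "id1 (tgt0 \<Sigma> (ssrc \<Sigma> f))"
    have c: "context_of \<Sigma> (ssrc \<Sigma> f) ?w ?w'"
      using st id1_in[OF polygraph] src0_in[OF polygraph] tgt0_in[OF polygraph]
      by (auto simp: context_of_def)
    have e: "edges ?w = []" "edges ?w' = []" by (auto simp: id1_def)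
    show ?thesis
      using True c trivial[OF st(1) c e] trivial[OF st(2) _ e] st(3) by metis
  next
    case False
    then obtain f1 g1 w w' where o: "overlapping \<Sigma> f1 g1" and c: "context_of \<Sigma> (ssrc \<Sigma> f1) w w'"
      and fg: "f = whisk w f1 w'" "g = whisk w g1 w'" and ne: "(f1, g1) \<noteq> (f, g)"
      using less.prems by (auto simp: critical_def branching_le_def)
    have s1: "is_step \<Sigma> f1" "is_step \<Sigma> g1" "ssrc \<Sigma> g1 = ssrc \<Sigma> f1"
      using o by (auto simp: overlapping_def local_branching_def)
    have "edges w \<noteq> [] \<or> edges w' \<noteq> []"
      using trivial[OF s1(1) c] trivial[OF s1(2), of w w'] s1(3) c fg ne by auto
    then have "length (edges (ssrc \<Sigma> f1)) < length (edges (ssrc \<Sigma> f))"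
      using fg by (auto simp: pcomp_def)
    from less.hyps[OF this o] obtain f0 g0 v v' where cr: "critical \<Sigma> f0 g0"
      and c0: "context_of \<Sigma> (ssrc \<Sigma> f0) v v'" and fg1: "f1 = whisk v f0 v'" "g1 = whisk v g0 v'"
      by blast
    have s0: "is_step \<Sigma> f0"
      using cr by (auto simp: critical_def overlapping_def local_branching_def)
    have "whisk w (whisk v h v') w' = whisk (w \<bullet> v) h (v' \<bullet> w')" for h :: "('v, 'e, 'r) step"
      by (cases h) (simp add: whisk_def)
    moreover have "context_of \<Sigma> (ssrc \<Sigma> f0) (w \<bullet> v) (v' \<bullet> w')"
      using c c0 s0 fg1 by (auto simp: context_of_def)
    ultimately show ?thesis using cr fg fg1 by metis
  qed
qed

lemma local_branching_filled_sd:
  assumes compat: "compatible_with_contexts \<Sigma> lt \<psi>"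
    and critical: "\<And>f g. critical \<Sigma> f g \<Longrightarrow> filled_sd lt \<psi> f g"
    and peiffer: "\<And>h k. peiffer_pair \<Sigma> h k \<Longrightarrow>
      filled_sd lt \<psi> (rwhisk h (ssrc \<Sigma> k)) (lwhisk (ssrc \<Sigma> h) k)"
    and "local_branching \<Sigma> f g"
  shows "filled_sd lt \<psi> f g"
proof -
  consider "f = g" | "peiffer_branching \<Sigma> f g" | "overlapping \<Sigma> f g"
    using assms(4) by (auto simp: overlapping_def)
  then show ?thesis
  proof cases
    case 1
    then show ?thesis using assms(4) by (auto simp: local_branching_def intro: filled_sd_refl)
  next
    case 2
    then show ?thesis
      \<comment> \<open>\<open>peiffer\<close> is oriented while a Peiffer branching is an unordered
        pair; symmetry covers the other orientation.\<close>
      unfolding peiffer_branching_def doubleton_eq_iff by (auto intro: peiffer filled_sd_sym)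
  next
    case 3
    from overlapping_above_critical[OF this] show ?thesis
      using filled_sd_whisk[OF compat critical] by blast
  qed
qed

end


section \<open>Greedy paths to quasi-normal forms\<close>

lemma rdist_le: "rewr_seq \<Sigma> u fs v \<Longrightarrow> rdist \<Sigma> u v \<le> length fs"
  unfolding rdist_def by (rule Least_le) blast

lemma rdist_attained:
  assumes "rewr_seq \<Sigma> u fs v"
  obtains gs where "rewr_seq \<Sigma> u gs v" "length gs = rdist \<Sigma> u v"
  unfolding rdist_def using LeastI_ex[of "\<lambda>n. \<exists>gs. rewr_seq \<Sigma> u gs v \<and> length gs = n"] assms
  by blast

locale qnf_presented_21_category = presented_21_category \<Sigma> R
  for \<Sigma> :: "('v, 'e, 'r) polygraph2" and R +
  fixes q :: "('v, 'e) path \<Rightarrow> ('v, 'e) path"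
  assumes qnf: "qnf_choice \<Sigma> q"
begin

abbreviation qdist :: "('v, 'e) path \<Rightarrow> nat" where
  "qdist u \<equiv> rdist \<Sigma> u (q u)"

lemma q_step: "is_step \<Sigma> f \<Longrightarrow> q (stgt \<Sigma> f) = q (ssrc \<Sigma> f)"
  using qnf step_cong[OF polygraph] unfolding qnf_choice_def by metis

lemma shortest_to_q:
  assumes "u \<in> cells1 \<Sigma>"
  obtains fs where "rewr_seq \<Sigma> u fs (q u)" "length fs = qdist u"
  using assms qnf rdist_attained unfolding qnf_choice_def quasi_normal_form_of_def by metis

text \<open>Prepend \<open>f\<close> to a shortest sequence from its target; both ends of
  \<open>f\<close> have the same chosen quasi-normal form.\<close>

lemma qdist_step_le: "is_step \<Sigma> f \<Longrightarrow> qdist (ssrc \<Sigma> f) \<le> Suc (qdist (stgt \<Sigma> f))"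
  by (rule shortest_to_q[of "stgt \<Sigma> f"])
    (use rdist_le[of \<Sigma> "ssrc \<Sigma> f" "f # _" "q (ssrc \<Sigma> f)"] in \<open>force simp: q_step\<close>)+

lemma q_eq_self: "u \<in> cells1 \<Sigma> \<Longrightarrow> qdist u = 0 \<Longrightarrow> q u = u"
  by (rule shortest_to_q[of u]) auto

text \<open>The first step of a shortest sequence works: its tail bounds the new distance from
  above, and \<open>qdist_step_le\<close> forbids a drop by more than one.\<close>

lemma ex_step_towards_q:
  assumes u: "u \<in> cells1 \<Sigma>" and pos: "qdist u \<noteq> 0"
  shows "\<exists>f. is_step \<Sigma> f \<and> ssrc \<Sigma> f = u \<and> qdist u = Suc (qdist (stgt \<Sigma> f))"
proof -
  obtain fs where fs: "rewr_seq \<Sigma> u fs (q u)" "length fs = qdist u"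
    by (rule shortest_to_q[OF u])
  with pos obtain f gs where f: "fs = f # gs" by (cases fs) auto
  then have s: "is_step \<Sigma> f" "ssrc \<Sigma> f = u" using fs by auto
  have "qdist (stgt \<Sigma> f) \<le> length gs"
    using rdist_le[of \<Sigma> "stgt \<Sigma> f" gs "q u"] fs f q_step[OF s(1)] by auto
  then show ?thesis
    using s f fs qdist_step_le[OF s(1)] by (intro exI[of _ f]) auto
qed

text \<open>The choice depends on \<open>u\<close> alone and not on a shortest sequence through
  \<open>u\<close>; this makes the tail of a greedy path the greedy path of the next 1-cell.\<close>

definition step_towards_q :: "('v, 'e) path \<Rightarrow> ('v, 'e, 'r) step" where
  "step_towards_q u = (SOME f. is_step \<Sigma> f \<and> ssrc \<Sigma> f = u \<and> qdist u = Suc (qdist (stgt \<Sigma> f)))"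

lemma step_towards_q:
  assumes "u \<in> cells1 \<Sigma>" "qdist u \<noteq> 0"
  shows "is_step \<Sigma> (step_towards_q u)" "ssrc \<Sigma> (step_towards_q u) = u"
    "qdist u = Suc (qdist (stgt \<Sigma> (step_towards_q u)))"
  unfolding step_towards_q_def using someI_ex[OF ex_step_towards_q[OF assms]] by auto

text \<open>Rewriting need not terminate, so the recursion runs on an explicit number of steps. The
  intended value is \<open>qdist u\<close>, which drops by exactly one at each greedy step.\<close>

primrec greedy :: "nat \<Rightarrow> ('v, 'e) path \<Rightarrow> ('v, 'e, 'r) step list" where
  "greedy 0 u = []"
| "greedy (Suc n) u = step_towards_q u # greedy n (stgt \<Sigma> (step_towards_q u))"

lemma greedy_rewr_seq:
  "u \<in> cells1 \<Sigma> \<Longrightarrow> qdist u = n \<Longrightarrow> rewr_seq \<Sigma> u (greedy n u) (q u)"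
proof (induction n arbitrary: u)
  case 0
  then show ?case using q_eq_self[of u] by simp
next
  case (Suc n)
  note s = step_towards_q[of u]
  have "rewr_seq \<Sigma> (stgt \<Sigma> (step_towards_q u)) (greedy n (stgt \<Sigma> (step_towards_q u)))
      (q (stgt \<Sigma> (step_towards_q u)))"
    using Suc s by (intro Suc.IH) auto
  then show ?case using Suc.prems s q_step[of "step_towards_q u"] by auto
qed

definition greedy_cell :: "('v, 'e) path \<Rightarrow> ('v, 'e, 'r) term2" where
  "greedy_cell u = seq_cell \<Sigma> u (greedy (qdist u) u)"

lemma greedy_cell_boundary:
  assumes "u \<in> cells1 \<Sigma>"
  shows "typed2 \<Sigma> (greedy_cell u)" "src1 \<Sigma> (greedy_cell u) = u" "tgt1 \<Sigma> (greedy_cell u) = q u"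
  using seq_cell_typed[OF greedy_rewr_seq[OF assms HOL.refl]] by (auto simp: greedy_cell_def)

lemma greedy_cell_unfold:
  assumes "u \<in> cells1 \<Sigma>" "qdist u \<noteq> 0"
  shows "greedy_cell u =
    step_cell (step_towards_q u) \<star>\<^sub>1 greedy_cell (stgt \<Sigma> (step_towards_q u))"
  unfolding greedy_cell_def using step_towards_q(3)[OF assms] by simp

lemma inverse_free_seq_cell: "inverse_free (seq_cell \<Sigma> u fs)"
proof (induction fs arbitrary: u)
  case (Cons f fs)
  then show ?case by (cases f) simp
qed simp

text \<open>The equations of the single steps telescope. They are assumed only for steps of
  \<open>fs\<close>, since the induction on labels provides them only for steps of small
  label.\<close>

lemma seq_cell_natural:
  "rewr_seq \<Sigma> u fs v \<Longrightarrow>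
    (\<And>h. h \<in> set fs \<Longrightarrow> step_cell h \<star>\<^sub>1 greedy_cell (stgt \<Sigma> h) \<approx> greedy_cell (ssrc \<Sigma> h)) \<Longrightarrow>
    seq_cell \<Sigma> u fs \<star>\<^sub>1 greedy_cell v \<approx> greedy_cell u"
proof (induction fs arbitrary: u)
  case Nil
  then show ?case by (auto intro!: eqR_unit_left simp: greedy_cell_boundary)
next
  case (Cons f fs)
  let ?x = "stgt \<Sigma> f"
  have s: "is_step \<Sigma> f" "ssrc \<Sigma> f = u" "rewr_seq \<Sigma> ?x fs v" using Cons.prems by auto
  note t = seq_cell_typed[OF s(3)] rewr_in[OF polygraph s(3)]
  note b = greedy_cell_boundary[OF t(2)]
  have "(step_cell f \<star>\<^sub>1 seq_cell \<Sigma> ?x fs) \<star>\<^sub>1 greedy_cell v \<approx>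
      step_cell f \<star>\<^sub>1 seq_cell \<Sigma> ?x fs \<star>\<^sub>1 greedy_cell v"
    using s t b by (intro eqR_assoc1) auto
  also have "\<dots> \<approx> step_cell f \<star>\<^sub>1 greedy_cell ?x"
    using s t b Cons by (intro eqR_comp1 eqR_refl Cons.IH) auto
  also have "\<dots> \<approx> greedy_cell u"
    using Cons.prems(2)[of f] s by simp
  finally show ?case by simp
qed

text \<open>A label is the distance of the target to its quasi-normal form, so the first greedy step \<open>g\<close>
  has label at most that of any \<open>f\<close> with the same source: all the other steps of a strictly
  decreasing diagram of \<open>(f, g)\<close> have labels smaller than that of \<open>f\<close>.  If there is no such \<open>g\<close>,
  then \<open>f\<close> followed by the greedy path is a loop.\<close>

lemma step_natural:
  assumes loops: "\<And>h. loop2 \<Sigma> h \<Longrightarrow> h \<approx> Id2 (src1 \<Sigma> h)"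
    and filled: "\<And>f g. local_branching \<Sigma> f g \<Longrightarrow> filled_sd (<) (qnf_label \<Sigma> q) f g"
  shows "is_step \<Sigma> f \<Longrightarrow> step_cell f \<star>\<^sub>1 greedy_cell (stgt \<Sigma> f) \<approx> greedy_cell (ssrc \<Sigma> f)"
proof (induction "qnf_label \<Sigma> q f" arbitrary: f rule: less_induct)
  case less
  let ?u = "ssrc \<Sigma> f" and ?v = "stgt \<Sigma> f"
  have u: "?u \<in> cells1 \<Sigma>" "?v \<in> cells1 \<Sigma>" using less.prems by auto
  note bu = greedy_cell_boundary[OF u(1)] and bv = greedy_cell_boundary[OF u(2)]
  show ?case
  proof (cases "qdist ?u = 0")
    case True
    let ?h = "step_cell f \<star>\<^sub>1 greedy_cell ?v"
    have "inverse_free (step_cell f)" by (cases f) simp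
    moreover have "inverse_free (greedy_cell ?v)"
      by (simp add: greedy_cell_def inverse_free_seq_cell)
    \<comment> \<open>The greedy path of \<open>?v\<close> ends at \<open>q ?v\<close>, which equals
      \<open>q ?u\<close> because \<open>f\<close> is a step, and \<open>q ?u\<close> is
      \<open>?u\<close> at distance 0. The greedy cell of \<open>?u\<close> is then an identity,
      which turns triviality of the loop into the claim.\<close>
    ultimately have "loop2 \<Sigma> ?h"
      using less.prems bv q_step q_eq_self[OF u(1) True] by (simp add: loop2_def cells2_def)
    then have "?h \<approx> Id2 ?u" using loops[of ?h] by simp
    then show ?thesis using True by (simp add: greedy_cell_def)
  next
    case False
    define g where "g = step_towards_q ?u"
    note g = step_towards_q[OF u(1) False, folded g_def]
    let ?w = "stgt \<Sigma> g"
    \<comment> \<open>Labels measure targets: \<open>qdist ?u\<close> is exactly one more than the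
      label of \<open>g\<close> and at most one more than the label of \<open>f\<close>. The weak
      inequality is enough, since steps of \<open>g'\<close> lie strictly below
      \<open>g\<close>.\<close>
    have gl: "qnf_label \<Sigma> q g \<le> qnf_label \<Sigma> q f"
      using g(3) qdist_step_le[OF less.prems] by (simp add: qnf_label_def)
    have "local_branching \<Sigma> f g" using g less.prems by (simp add: local_branching_def)
    then obtain f' g' where d: "sd_diagram \<Sigma> (<) (qnf_label \<Sigma> q) f f' g g'"
      and eq: "step_cell f \<star>\<^sub>1 seq_cell \<Sigma> ?v f' \<approx> step_cell g \<star>\<^sub>1 seq_cell \<Sigma> ?w g'"
      using filled unfolding filled_sd_def by fastforce
    obtain y where s: "rewr_seq \<Sigma> ?v f' y" "rewr_seq \<Sigma> ?w g' y"
      using d by (auto simp: sd_diagram_def confluence_diagram_def)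
    have steps: "is_step \<Sigma> h" if "rewr_seq \<Sigma> z hs y" "h \<in> set hs" for h hs z
      using that by (induction hs arbitrary: z) auto
    have f': "seq_cell \<Sigma> ?v f' \<star>\<^sub>1 greedy_cell y \<approx> greedy_cell ?v"
      using d s(1) by (intro seq_cell_natural less.hyps) (auto simp: sd_diagram_def intro: steps)
    have g': "seq_cell \<Sigma> ?w g' \<star>\<^sub>1 greedy_cell y \<approx> greedy_cell ?w"
      using d s(2) gl by (intro seq_cell_natural less.hyps)
        (auto simp: sd_diagram_def intro: steps dest!: bspec)
    note t = seq_cell_typed[OF s(1)] seq_cell_typed[OF s(2)]
      greedy_cell_boundary[OF rewr_in[OF polygraph s(1)]]
    have "step_cell f \<star>\<^sub>1 greedy_cell ?v \<approx> step_cell f \<star>\<^sub>1 seq_cell \<Sigma> ?v f' \<star>\<^sub>1 greedy_cell y"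
      using less.prems t bv by (intro eqR_comp1 eqR_refl cong2.sym[OF f']) auto
    also have "\<dots> \<approx> (step_cell f \<star>\<^sub>1 seq_cell \<Sigma> ?v f') \<star>\<^sub>1 greedy_cell y"
      using less.prems t by (intro cong2.sym[OF eqR_assoc1]) auto
    also have "\<dots> \<approx> (step_cell g \<star>\<^sub>1 seq_cell \<Sigma> ?w g') \<star>\<^sub>1 greedy_cell y"
      using t by (intro eqR_comp1 eqR_refl eq) auto
    also have "\<dots> \<approx> step_cell g \<star>\<^sub>1 seq_cell \<Sigma> ?w g' \<star>\<^sub>1 greedy_cell y"
      using g t by (intro eqR_assoc1) auto
    also have "\<dots> \<approx> step_cell g \<star>\<^sub>1 greedy_cell ?w"
      using g t by (intro eqR_comp1 eqR_refl g') auto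
    \<comment> \<open>The label of \<open>g\<close> may equal that of \<open>f\<close>, so the
      induction hypothesis does not cover \<open>g\<close>; its equation holds by construction of
      the greedy path.\<close>
    also have "step_cell g \<star>\<^sub>1 greedy_cell ?w = greedy_cell ?u"
      using greedy_cell_unfold[OF u(1) False] by (simp add: g_def)
    finally show ?thesis .
  qed
qed

end


section \<open>Congruence modulo a globular extension and 3-cells\<close>

text \<open>Having a 3-cell between them is a relation on 2-cells closed under the clauses of the
  congruence. The axioms cost only identity 3-cells, because boundaries are compared in the free
  (2,1)-category.\<close>

lemma eqmod_imp_cell3:
  assumes P: "two_polygraph \<Sigma>" and G: "globular_extension \<Sigma> \<Gamma>" and "eqmod \<Sigma> \<Gamma> f g"
  shows "\<exists>F. cell3 \<Sigma> \<Gamma> F f g"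
proof -
  interpret presented_21_category \<Sigma> "{}"
    using P by unfold_locales auto
  have cell3_id: "\<exists>F. cell3 \<Sigma> \<Gamma> F f g" if "eqR f g" for f g
    using that eqR_boundary(1)[OF that] eqR_refl
    by (intro exI[of _ "Id3 f"]) (simp add: cell3_def eq21_def cells21_def)
  have cell3_comp1: "\<exists>H. cell3 \<Sigma> \<Gamma> H (f \<star>\<^sub>1 g) (f' \<star>\<^sub>1 g')"
    if ex: "\<exists>F. cell3 \<Sigma> \<Gamma> F f f'" "\<exists>F. cell3 \<Sigma> \<Gamma> F g g'"
      and m: "tgt1 \<Sigma> f = src1 \<Sigma> g" "tgt1 \<Sigma> f' = src1 \<Sigma> g'"
    for f f' g g'
  proof -
    obtain F K where F: "typed3 \<Sigma> \<Gamma> F" "eqR (src2 \<Gamma> F) f" "eqR (tgt2 \<Gamma> F) f'"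
      and K: "typed3 \<Sigma> \<Gamma> K" "eqR (src2 \<Gamma> K) g" "eqR (tgt2 \<Gamma> K) g'"
      using ex by (auto simp: cell3_def eq21_def)
    note b = eqR_boundary[OF F(2)] eqR_boundary[OF F(3)] eqR_boundary[OF K(2)] eqR_boundary[OF K(3)]
    have "eqR (src2 \<Gamma> F \<star>\<^sub>1 src2 \<Gamma> K) (f \<star>\<^sub>1 g)" "eqR (tgt2 \<Gamma> F \<star>\<^sub>1 tgt2 \<Gamma> K) (f' \<star>\<^sub>1 g')"
      using F K b m by (intro eqR_comp1; simp)+
    then show ?thesis
      using F K b m by (intro exI[of _ "Comp1_3 F K"]) (simp add: cell3_def eq21_def)
  qed
  have cell3_sym: "\<exists>F. cell3 \<Sigma> \<Gamma> F g f" if ex: "\<exists>F. cell3 \<Sigma> \<Gamma> F f g" for f g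
  proof -
    obtain F where "cell3 \<Sigma> \<Gamma> F f g" using ex ..
    then show ?thesis by (intro exI[of _ "Inv3 F"]) (simp add: cell3_def)
  qed
  have cell3_trans: "\<exists>F. cell3 \<Sigma> \<Gamma> F f h"
    if ex: "\<exists>F. cell3 \<Sigma> \<Gamma> F f g" "\<exists>F. cell3 \<Sigma> \<Gamma> F g h" for f g h
  proof -
    obtain F K where F: "typed3 \<Sigma> \<Gamma> F" "eqR (src2 \<Gamma> F) f" "eqR (tgt2 \<Gamma> F) g"
      and K: "typed3 \<Sigma> \<Gamma> K" "eqR (src2 \<Gamma> K) g" "eqR (tgt2 \<Gamma> K) h"
      using ex by (auto simp: cell3_def eq21_def)
    then show ?thesis
      using cong2.trans[OF F(3) cong2.sym[OF K(2)]]
      by (intro exI[of _ "Comp2_3 F K"]) (simp add: cell3_def eq21_def)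
  qed
  have cell3_boundary: "typed2 \<Sigma> f \<and> typed2 \<Sigma> g" if "\<exists>F. cell3 \<Sigma> \<Gamma> F f g" for f g
    using that eqR_boundary(2) by (auto simp: cell3_def eq21_def)
  have parallel: "src1 \<Sigma> f = src1 \<Sigma> g \<and> tgt1 \<Sigma> f = tgt1 \<Sigma> g" if "eqmod \<Sigma> \<Gamma> f g" for f g
    using cong2_boundary[OF P that[unfolded eqmod_def]] G
    by (auto simp: globular_extension_def)
  from \<open>eqmod \<Sigma> \<Gamma> f g\<close> show ?thesis
    unfolding eqmod_def
  proof (induction rule: cong2.induct)
    case (gen f g)
    then obtain A where "A \<in> gens3 \<Gamma>" "f = gsrc \<Gamma> A" "g = gtgt \<Gamma> A" by blast
    then show ?case
      using G eqR_refl
      by (intro exI[of _ "Gen3 A"])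
        (auto simp: cell3_def eq21_def globular_extension_def cells21_def)
  next
    case (comp0 f f' g g')
    obtain F K where F: "typed3 \<Sigma> \<Gamma> F" "eqR (src2 \<Gamma> F) f" "eqR (tgt2 \<Gamma> F) f'"
      and K: "typed3 \<Sigma> \<Gamma> K" "eqR (src2 \<Gamma> K) g" "eqR (tgt2 \<Gamma> K) g'"
      using comp0.IH by (auto simp: cell3_def eq21_def)
    note p = parallel[unfolded eqmod_def, OF comp0.hyps(1)]
      parallel[unfolded eqmod_def, OF comp0.hyps(2)]
    have m: "tgt0 \<Sigma> (src1 \<Sigma> f) = src0 (src1 \<Sigma> g)" using comp0.hyps by (simp add: cells21_def)
    note b = eqR_boundary[OF F(2)] eqR_boundary[OF F(3)] eqR_boundary[OF K(2)] eqR_boundary[OF K(3)]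
    have "eqR (src2 \<Gamma> F \<star>\<^sub>0 src2 \<Gamma> K) (f \<star>\<^sub>0 g)" "eqR (tgt2 \<Gamma> F \<star>\<^sub>0 tgt2 \<Gamma> K) (f' \<star>\<^sub>0 g')"
      using F K b m p by (intro eqR_comp0; simp)+
    then show ?case
      using F K b m by (intro exI[of _ "Comp0_3 F K"]) (simp add: cell3_def eq21_def)
  next
    case (comp1 f f' g g')
    note p = parallel[unfolded eqmod_def, OF comp1.hyps(1)]
      parallel[unfolded eqmod_def, OF comp1.hyps(2)]
    show ?case
      using comp1.IH comp1.hyps(3) p by (intro cell3_comp1) (auto simp: cells21_def)
  next
    case (inv f f')
    note p = parallel[unfolded eqmod_def, OF inv.hyps(1)]
    have t: "typed2 \<Sigma> f" "typed2 \<Sigma> f'" using cell3_boundary[OF inv.IH] by auto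
    \<comment> \<open>No constructor of 3-cells inverts along 1-cells. Instead the reversed 3-cell,
      from \<open>f'\<close> to \<open>f\<close>, is whiskered by \<open>Inv2 f\<close> and
      \<open>Inv2 f'\<close>; its source \<open>?m f'\<close> reduces to \<open>Inv2 f\<close> and
      its target \<open>?m f\<close> to \<open>Inv2 f'\<close>.\<close>
    let ?m = "\<lambda>h. Inv2 f \<star>\<^sub>1 h \<star>\<^sub>1 Inv2 f'"
    have "eqR (?m f) ((Inv2 f \<star>\<^sub>1 f) \<star>\<^sub>1 Inv2 f')"
      using t p by (intro cong2.sym[OF eqR_assoc1]) auto
    also have "eqR \<dots> (Id2 (tgt1 \<Sigma> f) \<star>\<^sub>1 Inv2 f')"
      using t p by (intro eqR_comp1 eqR_refl eqR_inv_left) auto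
    also have "eqR \<dots> (Inv2 f')" using t p by (intro eqR_unit_left) auto
    finally have r: "eqR (Inv2 f') (?m f)" by (rule cong2.sym)
    have "eqR (Inv2 f) (Inv2 f \<star>\<^sub>1 Id2 (src1 \<Sigma> f'))"
      using t p by (intro cong2.sym[OF eqR_unit_right]) auto
    also have "eqR \<dots> (?m f')"
      using t p by (intro eqR_comp1 eqR_refl cong2.sym[OF eqR_inv_right]) auto
    finally have l: "eqR (Inv2 f) (?m f')" .
    have "\<exists>F. cell3 \<Sigma> \<Gamma> F (?m f') (?m f)"
      by (intro cell3_comp1[OF cell3_id[OF eqR_refl]]
          cell3_comp1[OF cell3_sym[OF inv.IH] cell3_id[OF eqR_refl]]) (use t p in auto)
    then show ?case using cell3_trans[OF cell3_id[OF l]] cell3_trans cell3_id[OF cong2.sym[OF r]] by blast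
  qed (blast intro: cell3_id cell3_sym cell3_trans cong2.intros)+
qed

theorem corollary3p2p3:
  fixes \<Sigma> :: "('v, 'e, 'r) polygraph2"
    and q :: "('v, 'e) path \<Rightarrow> ('v, 'e) path"
    and \<Gamma> :: "('v, 'e, 'r, 'a) cells3_ext"
  assumes "two_polygraph \<Sigma>"
    and "quasi_convergent \<Sigma>"
    and "qnf_choice \<Sigma> q"
    and "sd_squier_completion \<Sigma> (<) (qnf_label \<Sigma> q) \<Gamma>"
    and "compatible_with_contexts \<Sigma> (<) (qnf_label \<Sigma> q)"
    and "peiffer_decreasing \<Sigma> (<) (qnf_label \<Sigma> q) \<Gamma>"
  shows "coherent_presentation \<Sigma> \<Gamma>"
proof -
  let ?\<psi> = "qnf_label \<Sigma> q"
  obtain \<O> \<L> where gens: "gens3 \<Gamma> = \<O> \<union> \<L>"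
    and sd: "generating_sd_confluences \<Sigma> (<) ?\<psi> (\<Gamma>\<lparr>gens3 := \<O>\<rparr>)"
    and loop: "loop_extension \<Sigma> (\<Gamma>\<lparr>gens3 := \<L>\<rparr>)"
    using assms(4) unfolding sd_squier_completion_def by blast
  have G: "globular_extension \<Sigma> \<Gamma>"
    using gens sd loop
    unfolding generating_sd_confluences_def loop_extension_def globular_extension_def by auto
  let ?R = "{(gsrc \<Gamma> A, gtgt \<Gamma> A) | A. A \<in> gens3 \<Gamma>}"
  interpret qnf_presented_21_category \<Sigma> ?R q
    using assms(1,3) G by unfold_locales (auto simp: globular_extension_def)
  have eqmod: "eqmod \<Sigma> \<Gamma> f g \<longleftrightarrow> eqR f g" for f g by (simp add: eqmod_def)
  have gen: "eqR (gsrc \<Gamma> A) (gtgt \<Gamma> A)" if "A \<in> gens3 \<Gamma>" for A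
    using that by (intro cong2.gen) blast
  have elementary: "eqR f (Id2 (src1 \<Sigma> f))" if el: "elementary_loop \<Sigma> f" for f
  proof -
    obtain T A where T: "loop_representatives \<Sigma> T" "bij_betw A T \<L>"
      and A: "\<And>\<alpha>. \<alpha> \<in> T \<Longrightarrow> eq21 \<Sigma> (gsrc \<Gamma> (A \<alpha>)) \<alpha>"
        "\<And>\<alpha>. \<alpha> \<in> T \<Longrightarrow> eq21 \<Sigma> (gtgt \<Gamma> (A \<alpha>)) (Id2 (src1 \<Sigma> \<alpha>))"
      using loop unfolding loop_extension_def by auto
    then obtain \<alpha> where \<alpha>: "\<alpha> \<in> T" "loop_equiv \<Sigma> f \<alpha>"
      using el unfolding loop_representatives_def by blast
    have "A \<alpha> \<in> gens3 \<Gamma>" using bij_betwE[OF T(2)] \<alpha>(1) gens by blast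
    then have "eqR \<alpha> (Id2 (src1 \<Sigma> \<alpha>))"
      using cong2.trans[OF cong2.sym[OF eq21_imp_eqR[OF A(1)[OF \<alpha>(1)]]]
          cong2.trans[OF gen eq21_imp_eqR[OF A(2)[OF \<alpha>(1)]]]] by blast
    then show ?thesis using loop_equiv_trivial[OF \<alpha>(2)] by blast
  qed
  have critical: "filled_sd (<) ?\<psi> f g" if cr: "critical \<Sigma> f g" for f g
  proof -
    obtain D where D: "bij_betw D {{f, g} | f g. critical \<Sigma> f g} \<O>"
      and fill: "\<And>f g. critical \<Sigma> f g \<Longrightarrow>
        \<exists>f' g'. sd_diagram \<Sigma> (<) ?\<psi> f f' g g' \<and>
          (let a = seq_cell \<Sigma> (ssrc \<Sigma> f) (f # f'); b = seq_cell \<Sigma> (ssrc \<Sigma> g) (g # g')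
           in eq21 \<Sigma> (gsrc \<Gamma> (D {f, g})) a \<and> eq21 \<Sigma> (gtgt \<Gamma> (D {f, g})) b \<or>
              eq21 \<Sigma> (gsrc \<Gamma> (D {f, g})) b \<and> eq21 \<Sigma> (gtgt \<Gamma> (D {f, g})) a)"
      using sd unfolding generating_sd_confluences_def Let_def by auto
    have "D {f, g} \<in> gens3 \<Gamma>"
      using bij_betwE[OF D] cr gens by blast
    note e = gen[OF this]
    \<comment> \<open>The generating 3-cell of a critical branching may point either way; this
      handles one direction and symmetry the other.\<close>
    have t: "eqR a b" if "eq21 \<Sigma> (gsrc \<Gamma> (D {f, g})) a" "eq21 \<Sigma> (gtgt \<Gamma> (D {f, g})) b" for a b
      by (rule cong2.trans[OF cong2.sym[OF eq21_imp_eqR[OF that(1)]]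
            cong2.trans[OF e eq21_imp_eqR[OF that(2)]]])
    show ?thesis
      using fill[OF cr] unfolding filled_sd_def Let_def by (blast intro: t cong2.sym)
  qed
  have peiffer: "filled_sd (<) ?\<psi> (rwhisk h (ssrc \<Sigma> k)) (lwhisk (ssrc \<Sigma> h) k)"
    if "peiffer_pair \<Sigma> h k" for h k
  proof -
    from that have "is_step \<Sigma> h" "is_step \<Sigma> k" "tgt0 \<Sigma> (ssrc \<Sigma> h) = src0 (ssrc \<Sigma> k)"
      by (auto simp: peiffer_pair_def)
    then show ?thesis
      using assms(6) that unfolding peiffer_decreasing_def Let_def eqmod
      by (blast intro: filled_sd_peiffer)
  qed
  note natural = step_natural[OF loop_trivial[OF elementary]
      local_branching_filled_sd[OF assms(5) critical peiffer]]
  have "\<exists>F. cell3 \<Sigma> \<Gamma> F f g" if "sphere2 \<Sigma> f g" for f g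
  proof -
    \<comment> \<open>The family \<open>\<tau>\<close> is \<open>greedy_cell\<close>, fixed by
      unification with \<open>natural\<close>.\<close>
    have "eqR f g"
      by (rule parallel_eqR_if_natural[OF _ natural that]) (auto simp: greedy_cell_boundary)
    then show ?thesis
      using eqmod_imp_cell3[OF assms(1) G] eqmod by blast
  qed
  then show ?thesis using G by (simp add: coherent_presentation_def)
qed

end
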